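(* Let $\Gamma$ be a discrete I.C.C. group with an abelian subgroup $\Gamma_0$. Suppose the following condition holds: whenever $x_1,\ldots,x_m\in\Gamma$ and $$\Gamma_0\subseteq\bigcup_{i,j}x_i\Gamma_0x_j,$$ then $x_i\in\Gamma_0$ for some $i$. Then $VN(\Gamma_0)$ is a strongly singular masa of $VN(\Gamma)$.
   Context: I.C.C. means that every element other than the identity has an infinite conjugacy class. $VN(\Gamma)$ is the group von Neumann algebra generated by the left regular representation of $\Gamma$ on $\ell^2(\Gamma)$ (a type $\mathrm{II}_1$ factor when $\Gamma$ is I.C.C.); $VN(\Gamma_0)$ is identified with the von Neumann subalgebra of $VN(\Gamma)$ generated by $\Gamma_0$. In the union, $i,j$ range independently over $1,\ldots,m$. A masa is a maximal abelian self-adjoint subalgebra. For a type $\mathrm{II}_1$ factor $\mathcal{M}$ with faithful normal tracial state $tr$, put $\|x\|_2=(tr(x^*x))^{1/2}$, and for a linear map $\phi:\mathcal{M}\to\mathcal{M}$ put $\|\phi\|_{\infty,2}=\sup\{\|\phi(x)\|_2:\|x\|\le1\}$. For a von Neumann subalgebra $\mathcal{N}\subseteq\mathcal{M}$, $\mathbb{E}_{\mathcal{N}}$ is the unique trace preserving conditional expectation onto $\mathcal{N}$. A von Neumann subalgebra $\mathcal{A}\subseteq\mathcal{M}$ is strongly singular if $\|\mathbb{E}_{\mathcal{A}}-\mathbb{E}_{u\mathcal{A}u^*}\|_{\infty,2}\ge\|(I-\mathbb{E}_{\mathcal{A}})(u)\|_2$ for all unitaries $u\in\mathcal{M}$. 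*)

theory Defs
  imports
    "HOL-Analysis.Infinite_Sum"
    "HOL-Library.Nonpos_Ints"
    "HOL-Library.FuncSet"
    "HOL-Algebra.Coset"
begin

section \<open>The Hilbert space of square summable functions on a set\<close>

text \<open>Vectors are functions on the whole type that vanish off the index set \<open>S\<close>, so that
  equality of vectors is equality of functions. No countability of \<open>S\<close> is assumed.\<close>

type_synonym 'a vec = "'a \<Rightarrow> complex"

definition ell2 :: "'a set \<Rightarrow> 'a vec set" where
  "ell2 S = {f. (\<forall>x. x \<notin> S \<longrightarrow> f x = 0) \<and> (\<lambda>x. (cmod (f x))\<^sup>2) summable_on S}"

definition ell2_inner :: "'a set \<Rightarrow> 'a vec \<Rightarrow> 'a vec \<Rightarrow> complex" where
  "ell2_inner S f g = (\<Sum>\<^sub>\<infinity>x\<in>S. f x * cnj (g x))"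

definition ell2_norm :: "'a set \<Rightarrow> 'a vec \<Rightarrow> real" where
  "ell2_norm S f = sqrt (\<Sum>\<^sub>\<infinity>x\<in>S. (cmod (f x))\<^sup>2)"

section \<open>Bounded operators\<close>

text \<open>Operators are extensional functions on \<^term>\<open>ell2 S\<close> (undefined elsewhere), so that equality
  of operators is equality of functions. The product of \<open>T\<close> and \<open>U\<close> is
  \<^term>\<open>compose (ell2 S) T U\<close>.\<close>

type_synonym 'a op = "'a vec \<Rightarrow> 'a vec"

definition bounded_ops :: "'a set \<Rightarrow> 'a op set" where
  "bounded_ops S = {T \<in> ell2 S \<rightarrow>\<^sub>E ell2 S.
     (\<forall>f\<in>ell2 S. \<forall>g\<in>ell2 S. T (\<lambda>x. f x + g x) = (\<lambda>x. T f x + T g x)) \<and>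
     (\<forall>c. \<forall>f\<in>ell2 S. T (\<lambda>x. c * f x) = (\<lambda>x. c * T f x)) \<and>
     (\<exists>K. \<forall>f\<in>ell2 S. ell2_norm S (T f) \<le> K * ell2_norm S f)}"

definition op_norm :: "'a set \<Rightarrow> 'a op \<Rightarrow> real" where
  "op_norm S T = (SUP f\<in>{f \<in> ell2 S. ell2_norm S f \<le> 1}. ell2_norm S (T f))"

definition op_one :: "'a set \<Rightarrow> 'a op" where
  "op_one S = (\<lambda>f\<in>ell2 S. f)"

definition op_add :: "'a set \<Rightarrow> 'a op \<Rightarrow> 'a op \<Rightarrow> 'a op" where
  "op_add S T U = (\<lambda>f\<in>ell2 S. \<lambda>x. T f x + U f x)"

definition op_diff :: "'a set \<Rightarrow> 'a op \<Rightarrow> 'a op \<Rightarrow> 'a op" where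
  "op_diff S T U = (\<lambda>f\<in>ell2 S. \<lambda>x. T f x - U f x)"

definition op_scale :: "'a set \<Rightarrow> complex \<Rightarrow> 'a op \<Rightarrow> 'a op" where
  "op_scale S c T = (\<lambda>f\<in>ell2 S. \<lambda>x. c * T f x)"

definition op_adj :: "'a set \<Rightarrow> 'a op \<Rightarrow> 'a op" where
  "op_adj S T = (THE U. U \<in> bounded_ops S \<and>
     (\<forall>f\<in>ell2 S. \<forall>g\<in>ell2 S. ell2_inner S (T f) g = ell2_inner S f (U g)))"

definition op_positive :: "'a set \<Rightarrow> 'a op \<Rightarrow> bool" where
  "op_positive S T \<longleftrightarrow> T \<in> bounded_ops S \<and> (\<forall>f\<in>ell2 S. ell2_inner S (T f) f \<in> \<real>\<^sub>\<ge>\<^sub>0)"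

section \<open>Von Neumann algebras\<close>

definition commutant :: "'a set \<Rightarrow> 'a op set \<Rightarrow> 'a op set" where
  "commutant S M =
     {T \<in> bounded_ops S. \<forall>U\<in>M. compose (ell2 S) T U = compose (ell2 S) U T}"

text \<open>Dixmier's definition: self-adjoint and equal to the bicommutant. A commutant is always a
  unital algebra of bounded operators, so these properties need not be listed.\<close>

definition von_neumann_algebra :: "'a set \<Rightarrow> 'a op set \<Rightarrow> bool" where
  "von_neumann_algebra S M \<longleftrightarrow>
     (\<forall>T\<in>M. op_adj S T \<in> M) \<and> commutant S (commutant S M) = M"

definition vn_generated :: "'a set \<Rightarrow> 'a op set \<Rightarrow> 'a op set" where
  "vn_generated S X = \<Inter>{M. von_neumann_algebra S M \<and> X \<subseteq> M}"

definition unitaries :: "'a set \<Rightarrow> 'a op set \<Rightarrow> 'a op set" where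
  "unitaries S M = {u \<in> M. compose (ell2 S) (op_adj S u) u = op_one S \<and>
                           compose (ell2 S) u (op_adj S u) = op_one S}"

definition op_conj :: "'a set \<Rightarrow> 'a op \<Rightarrow> 'a op \<Rightarrow> 'a op" where
  "op_conj S u a = compose (ell2 S) u (compose (ell2 S) a (op_adj S u))"

definition abelian_sa_subalgebra :: "'a set \<Rightarrow> 'a op set \<Rightarrow> 'a op set \<Rightarrow> bool" where
  "abelian_sa_subalgebra S M A \<longleftrightarrow> A \<subseteq> M \<and> A \<noteq> {} \<and>
     (\<forall>a\<in>A. \<forall>b\<in>A. op_add S a b \<in> A) \<and>
     (\<forall>c. \<forall>a\<in>A. op_scale S c a \<in> A) \<and>
     (\<forall>a\<in>A. \<forall>b\<in>A. compose (ell2 S) a b \<in> A) \<and>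
     (\<forall>a\<in>A. op_adj S a \<in> A) \<and>
     (\<forall>a\<in>A. \<forall>b\<in>A. compose (ell2 S) a b = compose (ell2 S) b a)"

definition masa :: "'a set \<Rightarrow> 'a op set \<Rightarrow> 'a op set \<Rightarrow> bool" where
  "masa S M A \<longleftrightarrow> abelian_sa_subalgebra S M A \<and>
     (\<forall>B. abelian_sa_subalgebra S M B \<and> A \<subseteq> B \<longrightarrow> B = A)"

section \<open>Trace norms, conditional expectations, strong singularity\<close>

text \<open>In this section \<open>M\<close> is a finite von Neumann algebra on \<^term>\<open>ell2 S\<close> and \<open>tr\<close> a faithful
  normal tracial state on it; these assumptions are not part of the definitions.\<close>

definition trace_norm2 :: "'a set \<Rightarrow> ('a op \<Rightarrow> complex) \<Rightarrow> 'a op \<Rightarrow> real" where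
  "trace_norm2 S tr x = sqrt (Re (tr (compose (ell2 S) (op_adj S x) x)))"

definition norm_inf_2 ::
  "'a set \<Rightarrow> 'a op set \<Rightarrow> ('a op \<Rightarrow> complex) \<Rightarrow> ('a op \<Rightarrow> 'a op) \<Rightarrow> real" where
  "norm_inf_2 S M tr \<phi> = (SUP x\<in>{x \<in> M. op_norm S x \<le> 1}. trace_norm2 S tr (\<phi> x))"

text \<open>Extensionality in \<open>E\<close> is what makes the conditional expectation unique as a HOL function.\<close>

definition trace_preserving_cond_exp ::
  "'a set \<Rightarrow> 'a op set \<Rightarrow> ('a op \<Rightarrow> complex) \<Rightarrow> 'a op set \<Rightarrow> ('a op \<Rightarrow> 'a op) \<Rightarrow> bool" where
  "trace_preserving_cond_exp S M tr N E \<longleftrightarrow> E \<in> M \<rightarrow>\<^sub>E N \<and>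
     (\<forall>x\<in>M. \<forall>y\<in>M. E (op_add S x y) = op_add S (E x) (E y)) \<and>
     (\<forall>c. \<forall>x\<in>M. E (op_scale S c x) = op_scale S c (E x)) \<and>
     (\<forall>x\<in>M. op_positive S x \<longrightarrow> op_positive S (E x)) \<and>
     (\<forall>a\<in>N. E a = a) \<and>
     (\<forall>a\<in>N. \<forall>b\<in>N. \<forall>x\<in>M. E (compose (ell2 S) a (compose (ell2 S) x b)) =
                                compose (ell2 S) a (compose (ell2 S) (E x) b)) \<and>
     (\<forall>x\<in>M. tr (E x) = tr x)"

definition cond_exp ::
  "'a set \<Rightarrow> 'a op set \<Rightarrow> ('a op \<Rightarrow> complex) \<Rightarrow> 'a op set \<Rightarrow> 'a op \<Rightarrow> 'a op" where
  "cond_exp S M tr N = (THE E. trace_preserving_cond_exp S M tr N E)"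

definition strongly_singular ::
  "'a set \<Rightarrow> 'a op set \<Rightarrow> ('a op \<Rightarrow> complex) \<Rightarrow> 'a op set \<Rightarrow> bool" where
  "strongly_singular S M tr A \<longleftrightarrow> von_neumann_algebra S A \<and> A \<subseteq> M \<and>
     (\<forall>u\<in>unitaries S M.
        norm_inf_2 S M tr
          (\<lambda>x. op_diff S (cond_exp S M tr A x) (cond_exp S M tr (op_conj S u ` A) x))
        \<ge> trace_norm2 S tr (op_diff S u (cond_exp S M tr A u)))"

section \<open>Group von Neumann algebras\<close>

definition icc_group :: "('a, 'b) monoid_scheme \<Rightarrow> bool" where
  "icc_group G \<longleftrightarrow> group G \<and>
     (\<forall>g\<in>carrier G - {\<one>\<^bsub>G\<^esub>}.
        infinite {h \<otimes>\<^bsub>G\<^esub> g \<otimes>\<^bsub>G\<^esub> inv\<^bsub>G\<^esub> h | h. h \<in> carrier G})"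

definition left_regular :: "('a, 'b) monoid_scheme \<Rightarrow> 'a \<Rightarrow> 'a op" where
  "left_regular G g = (\<lambda>f\<in>ell2 (carrier G).
     \<lambda>x. if x \<in> carrier G then f (inv\<^bsub>G\<^esub> g \<otimes>\<^bsub>G\<^esub> x) else 0)"

text \<open>The von Neumann algebra on \<^term>\<open>ell2 (carrier G)\<close> generated by the left translations by
  elements of \<open>H\<close>. For \<^term>\<open>H = carrier G\<close> this is the group von Neumann algebra of \<open>G\<close>; for a
  subgroup \<open>H\<close> it is the copy of the group von Neumann algebra of \<open>H\<close> inside that of \<open>G\<close>.\<close>

definition VN :: "('a, 'b) monoid_scheme \<Rightarrow> 'a set \<Rightarrow> 'a op set" where
  "VN G H = vn_generated (carrier G) (left_regular G ` H)"

definition delta_one :: "('a, 'b) monoid_scheme \<Rightarrow> 'a vec" where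
  "delta_one G = (\<lambda>x. if x = \<one>\<^bsub>G\<^esub> then 1 else 0)"

text \<open>The canonical trace; when \<open>G\<close> is I.C.C. it is the only tracial state of the factor
  \<^term>\<open>VN G (carrier G)\<close>.\<close>

definition group_trace :: "('a, 'b) monoid_scheme \<Rightarrow> 'a op \<Rightarrow> complex" where
  "group_trace G x = ell2_inner (carrier G) (x (delta_one G)) (delta_one G)"

end

theory Submission
  imports Defs "HOL-Analysis.L2_Norm" "HOL-Analysis.Elementary_Metric_Spaces"
begin

text \<open>
  An operator \<open>T\<close> in \<open>VN(\<Gamma>)\<close> is determined by its coefficient vector \<open>\<xi> = T \<delta>\<^sub>1\<close>: its matrix entry at
  \<open>(y, b)\<close> is \<open>\<xi>(b y\<^sup>-\<^sup>1)\<close>. The algebra \<open>A = VN(\<Gamma>\<^sub>0)\<close> consists of the operators whose coefficients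
  vanish off \<open>\<Gamma>\<^sub>0\<close> (\<open>VN_eq_convolution_ops\<close>, resting on \<open>double_commutant_left_regular\<close>). The trace of \<open>T\<close> is
  \<open>\<xi>(1)\<close>, its trace norm is the norm of \<open>\<xi>\<close>, the expectation \<open>E\<close> onto \<open>A\<close> restricts \<open>\<xi>\<close> to \<open>\<Gamma>\<^sub>0\<close>
  (\<open>cond_exp_eq_coset_compression\<close>), and the expectation onto \<open>u A u\<^sup>*\<close> is \<open>x \<mapsto> u E(u\<^sup>* x u) u\<^sup>*\<close>
  (\<open>cond_exp_conjugate\<close>). That restricting coefficients yields a bounded operator at all is the one
  delicate point: it is realized as compression to the blocks given by the cosets of \<open>\<Gamma>\<^sub>0\<close>.

  The covering hypothesis enters as a separation property (\<open>not_covered_imp_separation\<close>): for each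
  finite set \<open>F\<close> disjoint from \<open>\<Gamma>\<^sub>0\<close> there is \<open>\<gamma> \<in> \<Gamma>\<^sub>0\<close> such that no product \<open>x \<gamma> y\<close> with \<open>x, y \<in> F\<close> lies in
  \<open>\<Gamma>\<^sub>0\<close>.

  Maximality. If \<open>T\<close> commutes with \<open>A\<close>, its coefficients are constant on the orbits of conjugation
  by \<open>\<Gamma>\<^sub>0\<close>, so by square summability they vanish on infinite orbits. An element \<open>g\<close> off \<open>\<Gamma>\<^sub>0\<close> cannot
  have a finite orbit \<open>O\<close>, since \<open>g \<gamma> (\<gamma>\<^sup>-\<^sup>1 g\<^sup>-\<^sup>1 \<gamma>) = \<gamma>\<close> violates separation for \<open>O \<union> O\<^sup>-\<^sup>1\<close>. Hence \<open>T\<close> is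
  in \<open>A\<close> (\<open>relative_commutant_convolution_ops\<close>).

  Strong singularity. For a unitary \<open>u\<close> compare the two expectations at \<open>v = \<lambda>\<^sub>\<gamma>\<close> with \<open>\<gamma> \<in> \<Gamma>\<^sub>0\<close>. Since
  \<open>E(v) = v\<close>, the trace norm of their difference at \<open>v\<close> is that of \<open>u\<^sup>* v u - E(u\<^sup>* v u)\<close>, and its square
  is \<open>1 - p\<^sup>2\<close>, where \<open>p\<close> is the trace norm of \<open>E(u\<^sup>* v u)\<close>. Write \<open>u\<close> as \<open>E(u)\<close> plus a part with
  coefficients off \<open>\<Gamma>\<^sub>0\<close>. The latter is finitely supported up to a small error, and separation chooses
  \<open>\<gamma>\<close> so that its contribution to \<open>E(u\<^sup>* v u)\<close> is negligible. What remains is at most the trace norm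
  \<open>a\<close> of \<open>E(u)\<close> (\<open>asymptotic_homomorphism_estimate\<close>). So the squared distance of the expectations is at
  least \<open>1 - (a + e)\<^sup>2\<close> for every \<open>e > 0\<close>, hence at least \<open>1 - a\<^sup>2\<close>, the square of the trace norm of
  \<open>u - E(u)\<close>.
\<close>

section \<open>Square summable functions and their functionals\<close>

definition unit_vec :: "'a \<Rightarrow> 'a vec" where
  "unit_vec y = (\<lambda>x. if x = y then 1 else 0)"

definition restr :: "'a set \<Rightarrow> 'a vec \<Rightarrow> 'a vec" where
  "restr C f = (\<lambda>x. if x \<in> C then f x else 0)"

lemma restr_in [simp]: "x \<in> C \<Longrightarrow> restr C f x = f x"
  and restr_out [simp]: "x \<notin> C \<Longrightarrow> restr C f x = 0"
  by (simp_all add: restr_def)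

lemma ell2_outside: "f \<in> ell2 S \<Longrightarrow> x \<notin> S \<Longrightarrow> f x = 0"
  by (simp add: ell2_def)

lemma ell2_summable: "f \<in> ell2 S \<Longrightarrow> (\<lambda>x. (cmod (f x))\<^sup>2) summable_on S"
  by (simp add: ell2_def)

lemma ell2_norm_nonneg [simp]: "0 \<le> ell2_norm S f"
  by (simp add: ell2_norm_def infsum_nonneg)

lemma ell2_norm_squared: "(ell2_norm S f)\<^sup>2 = (\<Sum>\<^sub>\<infinity>x\<in>S. (cmod (f x))\<^sup>2)"
  by (simp add: ell2_norm_def infsum_nonneg)

lemma finite_sum_le_ell2_norm:
  assumes "f \<in> ell2 S" "finite F" "F \<subseteq> S"
  shows "(\<Sum>x\<in>F. (cmod (f x))\<^sup>2) \<le> (ell2_norm S f)\<^sup>2"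
  unfolding ell2_norm_squared
  using assms by (intro finite_sum_le_infsum ell2_summable) auto

lemma L2_set_le_ell2_norm:
  assumes "f \<in> ell2 S" "finite F" "F \<subseteq> S"
  shows "L2_set (\<lambda>x. cmod (f x)) F \<le> ell2_norm S f"
  unfolding L2_set_def using finite_sum_le_ell2_norm[OF assms]
  by (simp add: real_le_lsqrt sum_nonneg)

lemma cmod_le_ell2_norm:
  assumes "f \<in> ell2 S"
  shows "cmod (f x) \<le> ell2_norm S f"
proof (cases "x \<in> S")
  case True
  then show ?thesis using L2_set_le_ell2_norm[OF assms, of "{x}"] by (simp add: L2_set_def)
next
  case False
  then show ?thesis using assms by (simp add: ell2_outside)
qed

text \<open>Membership in \<^term>\<open>ell2 S\<close> and a bound on the norm both come down to one estimate on finite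
  partial sums. Minkowski's inequality and the Riesz representation below are therefore proved on
  finite sets only.\<close>
lemma ell2_boundI:
  assumes out: "\<And>x. x \<notin> S \<Longrightarrow> f x = 0" and B: "0 \<le> B"
    and fin: "\<And>F. finite F \<Longrightarrow> F \<subseteq> S \<Longrightarrow> (\<Sum>x\<in>F. (cmod (f x))\<^sup>2) \<le> B\<^sup>2"
  shows "f \<in> ell2 S" and "ell2_norm S f \<le> B"
proof -
  have s: "(\<lambda>x. (cmod (f x))\<^sup>2) summable_on S"
    by (rule nonneg_bdd_above_summable_on) (auto intro!: bdd_aboveI2[where M = "B\<^sup>2"] fin)
  then show "f \<in> ell2 S" using out by (simp add: ell2_def)
  have "(ell2_norm S f)\<^sup>2 \<le> B\<^sup>2"
    unfolding ell2_norm_squared by (rule infsum_le_finite_sums[OF s fin])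
  then show "ell2_norm S f \<le> B" using B by (rule power2_le_imp_le)
qed

lemma L2_set_boundI:
  assumes "\<And>x. x \<notin> S \<Longrightarrow> f x = 0" "0 \<le> B"
    and fin: "\<And>F. finite F \<Longrightarrow> F \<subseteq> S \<Longrightarrow> L2_set (\<lambda>x. cmod (f x)) F \<le> B"
  shows "f \<in> ell2 S" and "ell2_norm S f \<le> B"
proof -
  have "(\<Sum>x\<in>F. (cmod (f x))\<^sup>2) \<le> B\<^sup>2" if "finite F" "F \<subseteq> S" for F
    using fin[OF that] by (simp add: L2_set_def sqrt_le_D)
  then show "f \<in> ell2 S" "ell2_norm S f \<le> B" using ell2_boundI[of S f B] assms by auto
qed

text \<open>Each point of the level set contributes the same positive amount to the square sum.\<close>
lemma ell2_level_set_finite: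
  assumes "f \<in> ell2 S" "c \<noteq> 0"
  shows "finite {x \<in> S. f x = c}"
proof (rule ccontr)
  assume inf: "infinite {x \<in> S. f x = c}"
  obtain n :: nat where n: "(ell2_norm S f)\<^sup>2 / (cmod c)\<^sup>2 < real n" using reals_Archimedean2 by blast
  obtain B where B: "finite B" "card B = n" "B \<subseteq> {x \<in> S. f x = c}"
    using infinite_arbitrarily_large[OF inf] by blast
  have "real n * (cmod c)\<^sup>2 = (\<Sum>x\<in>B. (cmod (f x))\<^sup>2)"
    using B by (subst sum.cong[where h = "\<lambda>_. (cmod c)\<^sup>2", OF refl]) auto
  also have "\<dots> \<le> (ell2_norm S f)\<^sup>2"
    using B by (intro finite_sum_le_ell2_norm[OF assms(1)]) auto
  finally show False using n assms(2) by (simp add: field_simps)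
qed

lemma ell2_add_norm:
  assumes f: "f \<in> ell2 S" and g: "g \<in> ell2 S"
  shows ell2_add: "(\<lambda>x. f x + g x) \<in> ell2 S"
    and ell2_norm_triangle: "ell2_norm S (\<lambda>x. f x + g x) \<le> ell2_norm S f + ell2_norm S g"
proof -
  have "L2_set (\<lambda>x. cmod (f x + g x)) F \<le> ell2_norm S f + ell2_norm S g"
    if "finite F" "F \<subseteq> S" for F
  proof -
    have "L2_set (\<lambda>x. cmod (f x + g x)) F \<le> L2_set (\<lambda>x. cmod (f x) + cmod (g x)) F"
      by (rule L2_set_mono) (auto intro: norm_triangle_ineq)
    also have "\<dots> \<le> L2_set (\<lambda>x. cmod (f x)) F + L2_set (\<lambda>x. cmod (g x)) F"
      by (rule L2_set_triangle_ineq)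
    also have "\<dots> \<le> ell2_norm S f + ell2_norm S g"
      using L2_set_le_ell2_norm[OF f that] L2_set_le_ell2_norm[OF g that] by simp
    finally show ?thesis .
  qed
  then show "(\<lambda>x. f x + g x) \<in> ell2 S"
    "ell2_norm S (\<lambda>x. f x + g x) \<le> ell2_norm S f + ell2_norm S g"
    using L2_set_boundI[of S "\<lambda>x. f x + g x" "ell2_norm S f + ell2_norm S g"] f g
    by (auto simp: ell2_outside)
qed

lemma ell2_scale:
  assumes "f \<in> ell2 S"
  shows "(\<lambda>x. c * f x) \<in> ell2 S"
  using assms unfolding ell2_def
  by (auto simp: norm_mult power_mult_distrib intro: summable_on_cmult_right)

lemma ell2_norm_scale: "ell2_norm S (\<lambda>x. c * f x) = cmod c * ell2_norm S f"
  unfolding ell2_norm_def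
  by (simp add: norm_mult power_mult_distrib infsum_cmult_right' real_sqrt_mult)

lemma ell2_diff:
  assumes "f \<in> ell2 S" "g \<in> ell2 S"
  shows "(\<lambda>x. f x - g x) \<in> ell2 S"
  using ell2_add[OF assms(1) ell2_scale[OF assms(2), of "-1"]] by simp

lemma ell2_zero [simp]: "(\<lambda>x. 0) \<in> ell2 S"
  by (simp add: ell2_def)

lemma ell2_norm_zero [simp]: "ell2_norm S (\<lambda>x. 0) = 0"
  by (simp add: ell2_norm_def)

lemma ell2_norm_diff_triangle:
  assumes "f \<in> ell2 S" "g \<in> ell2 S"
  shows "ell2_norm S (\<lambda>x. f x - g x) \<le> ell2_norm S f + ell2_norm S g"
  using ell2_norm_triangle[OF assms(1) ell2_scale[OF assms(2), of "-1"]]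
    ell2_norm_scale[of S "-1" g] by simp

lemma restr_ell2:
  assumes "f \<in> ell2 S"
  shows "restr C f \<in> ell2 S" and "ell2_norm S (restr C f) \<le> ell2_norm S f"
proof -
  have "(\<Sum>x\<in>F. (cmod (restr C f x))\<^sup>2) \<le> (ell2_norm S f)\<^sup>2" if "finite F" "F \<subseteq> S" for F
  proof -
    have "(\<Sum>x\<in>F. (cmod (restr C f x))\<^sup>2) \<le> (\<Sum>x\<in>F. (cmod (f x))\<^sup>2)"
      by (rule sum_mono) (simp add: restr_def)
    then show ?thesis using finite_sum_le_ell2_norm[OF assms that] by simp
  qed
  then show "restr C f \<in> ell2 S" "ell2_norm S (restr C f) \<le> ell2_norm S f"
    using ell2_boundI[of S "restr C f" "ell2_norm S f"] assms by (auto simp: ell2_outside restr_def)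
qed

lemma restr_add: "restr C (\<lambda>x. f x + g x) = (\<lambda>x. restr C f x + restr C g x)"
  and restr_scale: "restr C (\<lambda>x. c * f x) = (\<lambda>x. c * restr C f x)"
  by (auto simp: restr_def)

lemma ell2_norm_restr_squared:
  "(ell2_norm S (restr C f))\<^sup>2 = (\<Sum>\<^sub>\<infinity>x\<in>S \<inter> C. (cmod (f x))\<^sup>2)"
  unfolding ell2_norm_squared by (rule infsum_cong_neutral) auto

lemma ell2_pythagoras:
  assumes "f \<in> ell2 S"
  shows "(ell2_norm S f)\<^sup>2 = (ell2_norm S (restr C f))\<^sup>2 + (ell2_norm S (restr (- C) f))\<^sup>2"
proof -
  have s: "(\<lambda>x. (cmod (f x))\<^sup>2) summable_on S" using assms by (rule ell2_summable)
  have "(\<Sum>\<^sub>\<infinity>x\<in>S \<inter> C \<union> S \<inter> - C. (cmod (f x))\<^sup>2) =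
    (\<Sum>\<^sub>\<infinity>x\<in>S \<inter> C. (cmod (f x))\<^sup>2) + (\<Sum>\<^sub>\<infinity>x\<in>S \<inter> - C. (cmod (f x))\<^sup>2)"
    by (rule infsum_Un_disjoint) (auto intro: summable_on_subset_banach[OF s])
  moreover have "S \<inter> C \<union> S \<inter> - C = S" by blast
  ultimately show ?thesis unfolding ell2_norm_restr_squared by (simp add: ell2_norm_squared)
qed

lemma unit_vec_ell2 [simp]: "y \<in> S \<Longrightarrow> unit_vec y \<in> ell2 S"
proof -
  assume "y \<in> S"
  then have "(\<lambda>x. (cmod (unit_vec y x))\<^sup>2) summable_on S \<longleftrightarrow> (\<lambda>x. 1::real) summable_on {y}"
    by (intro summable_on_cong_neutral) (auto simp: unit_vec_def)
  then show ?thesis using \<open>y \<in> S\<close> by (auto simp: ell2_def unit_vec_def)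
qed

lemma ell2_norm_unit_vec [simp]:
  assumes "y \<in> S" shows "ell2_norm S (unit_vec y) = 1"
proof -
  have "(\<Sum>\<^sub>\<infinity>x\<in>S. (cmod (unit_vec y x))\<^sup>2) = (\<Sum>\<^sub>\<infinity>x\<in>{y}. 1)"
    using assms by (intro infsum_cong_neutral) (auto simp: unit_vec_def)
  then show ?thesis by (simp add: ell2_norm_def)
qed

lemma ell2_norm_eq_0:
  assumes "f \<in> ell2 S" "ell2_norm S f = 0" shows "f = (\<lambda>x. 0)"
  using cmod_le_ell2_norm[OF assms(1)] assms(2) by auto

text \<open>By Pythagoras the squared error of a finite truncation is the total square sum minus the part already
  collected, so it tends to zero because the square sum converges.\<close>
lemma ell2_truncation_tendsto:
  assumes "f \<in> ell2 S"
  shows "((\<lambda>F. ell2_norm S (\<lambda>x. f x - restr F f x)) \<longlongrightarrow> 0) (finite_subsets_at_top S)"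
proof -
  have e: "ell2_norm S (\<lambda>x. f x - restr F f x) = sqrt ((ell2_norm S f)\<^sup>2 - (\<Sum>x\<in>F. (cmod (f x))\<^sup>2))"
    if "finite F" "F \<subseteq> S" for F
  proof -
    have "(\<lambda>x. f x - restr F f x) = restr (- F) f" by (auto simp: restr_def)
    moreover have "(ell2_norm S (restr F f))\<^sup>2 = (\<Sum>x\<in>F. (cmod (f x))\<^sup>2)"
      using that by (simp add: ell2_norm_restr_squared Int_absorb1)
    ultimately show ?thesis using ell2_pythagoras[OF assms, of F] by (simp add: real_sqrt_unique)
  qed
  have "((\<lambda>F. \<Sum>x\<in>F. (cmod (f x))\<^sup>2) \<longlongrightarrow> (ell2_norm S f)\<^sup>2) (finite_subsets_at_top S)"
    unfolding ell2_norm_squared by (rule infsum_tendsto[OF ell2_summable[OF assms]])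
  then have "((\<lambda>F. sqrt ((ell2_norm S f)\<^sup>2 - (\<Sum>x\<in>F. (cmod (f x))\<^sup>2))) \<longlongrightarrow>
    sqrt ((ell2_norm S f)\<^sup>2 - (ell2_norm S f)\<^sup>2)) (finite_subsets_at_top S)"
    by (intro tendsto_intros)
  then have "((\<lambda>F. sqrt ((ell2_norm S f)\<^sup>2 - (\<Sum>x\<in>F. (cmod (f x))\<^sup>2))) \<longlongrightarrow> 0) (finite_subsets_at_top S)"
    by simp
  then show ?thesis
    by (rule Lim_transform_eventually)
       (auto simp: eventually_finite_subsets_at_top e[symmetric] intro!: exI[of _ "{}"])
qed

lemma ell2_finite_approx:
  assumes "f \<in> ell2 S" "0 < e"
  obtains F where "finite F" "F \<subseteq> S" "ell2_norm S (\<lambda>x. f x - restr F f x) < e"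
proof -
  have "eventually (\<lambda>F. ell2_norm S (\<lambda>x. f x - restr F f x) < e) (finite_subsets_at_top S)"
    using order_tendstoD(2)[OF ell2_truncation_tendsto[OF assms(1)] assms(2)] .
  then show ?thesis using that by (auto simp: eventually_finite_subsets_at_top)
qed

lemma ell2_inner_has_sum:
  assumes f: "f \<in> ell2 S" and g: "g \<in> ell2 S"
  shows "((\<lambda>x. f x * cnj (g x)) has_sum ell2_inner S f g) S"
    and Cauchy_Schwarz_ell2: "cmod (ell2_inner S f g) \<le> ell2_norm S f * ell2_norm S g"
proof -
  have fin: "(\<Sum>x\<in>F. cmod (f x * cnj (g x))) \<le> ell2_norm S f * ell2_norm S g"
    if "finite F" "F \<subseteq> S" for F
  proof -
    have "(\<Sum>x\<in>F. cmod (f x * cnj (g x))) \<le> L2_set (\<lambda>x. cmod (f x)) F * L2_set (\<lambda>x. cmod (g x)) F"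
      using L2_set_mult_ineq[of "\<lambda>x. cmod (f x)" "\<lambda>x. cmod (g x)" F] by (simp add: norm_mult)
    also have "\<dots> \<le> ell2_norm S f * ell2_norm S g"
      by (intro mult_mono L2_set_le_ell2_norm f g that) auto
    finally show ?thesis .
  qed
  then have s: "(\<lambda>x. f x * cnj (g x)) abs_summable_on S"
    by (intro nonneg_bdd_above_summable_on) (auto intro!: bdd_aboveI2)
  show "((\<lambda>x. f x * cnj (g x)) has_sum ell2_inner S f g) S"
    unfolding ell2_inner_def by (rule has_sum_infsum[OF abs_summable_summable[OF s]])
  have "cmod (ell2_inner S f g) \<le> (\<Sum>\<^sub>\<infinity>x\<in>S. cmod (f x * cnj (g x)))"
    unfolding ell2_inner_def by (rule norm_infsum_bound[OF s])
  also have "\<dots> \<le> ell2_norm S f * ell2_norm S g"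
    by (rule infsum_le_finite_sums[OF s fin])
  finally show "cmod (ell2_inner S f g) \<le> ell2_norm S f * ell2_norm S g" .
qed

lemma ell2_inner_add_left:
  assumes "f \<in> ell2 S" "g \<in> ell2 S" "h \<in> ell2 S"
  shows "ell2_inner S (\<lambda>x. f x + g x) h = ell2_inner S f h + ell2_inner S g h"
  unfolding ell2_inner_def
  using has_sum_add[OF ell2_inner_has_sum(1)[OF assms(1,3)] ell2_inner_has_sum(1)[OF assms(2,3)]]
  by (simp add: ring_distribs infsumI ell2_inner_def)

lemma ell2_inner_scale_left: "ell2_inner S (\<lambda>x. c * f x) h = c * ell2_inner S f h"
  unfolding ell2_inner_def by (simp add: mult.assoc infsum_cmult_right')

lemma ell2_inner_cnj: "cnj (ell2_inner S f g) = ell2_inner S g f"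
  unfolding ell2_inner_def infsum_cnj[symmetric] by (simp add: mult.commute)

lemma ell2_inner_self: "f \<in> ell2 S \<Longrightarrow> ell2_inner S f f = of_real ((ell2_norm S f)\<^sup>2)"
proof -
  assume "f \<in> ell2 S"
  have "((\<lambda>x. f x * cnj (f x)) has_sum complex_of_real ((ell2_norm S f)\<^sup>2)) S"
    unfolding complex_norm_square[symmetric] of_real_power[symmetric] has_sum_of_real_iff ell2_norm_squared
    using \<open>f \<in> ell2 S\<close> by (simp add: ell2_summable)
  then show ?thesis unfolding ell2_inner_def by (rule infsumI)
qed

lemma ell2_inner_unit_vec_right:
  assumes "y \<in> S" shows "ell2_inner S f (unit_vec y) = f y"
proof -
  have "ell2_inner S f (unit_vec y) = (\<Sum>\<^sub>\<infinity>x\<in>{y}. f x)"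
    unfolding ell2_inner_def using assms
    by (intro infsum_cong_neutral) (auto simp: unit_vec_def)
  then show ?thesis by simp
qed

lemma ell2_inner_unit_vec_left:
  assumes "y \<in> S" shows "ell2_inner S (unit_vec y) f = cnj (f y)"
  using ell2_inner_unit_vec_right[OF assms, of f] ell2_inner_cnj[of S f "unit_vec y"] by simp

text \<open>The bound \<open>C\<close> is a parameter because it reappears as the norm bound of the representing vector,
  and through it as the bound of an adjoint operator.\<close>
definition bounded_functional :: "'a set \<Rightarrow> ('a vec \<Rightarrow> complex) \<Rightarrow> real \<Rightarrow> bool" where
  "bounded_functional S \<phi> C \<longleftrightarrow>
     (\<forall>f\<in>ell2 S. \<forall>g\<in>ell2 S. \<phi> (\<lambda>x. f x + g x) = \<phi> f + \<phi> g) \<and>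
     (\<forall>c. \<forall>f\<in>ell2 S. \<phi> (\<lambda>x. c * f x) = c * \<phi> f) \<and>
     (\<forall>f\<in>ell2 S. cmod (\<phi> f) \<le> C * ell2_norm S f)"

lemma bounded_functionalD:
  assumes "bounded_functional S \<phi> C" "f \<in> ell2 S"
  shows "g \<in> ell2 S \<Longrightarrow> \<phi> (\<lambda>x. f x + g x) = \<phi> f + \<phi> g"
    and "\<phi> (\<lambda>x. c * f x) = c * \<phi> f" and "cmod (\<phi> f) \<le> C * ell2_norm S f"
  using assms unfolding bounded_functional_def by auto

lemma bounded_functional_finite:
  assumes \<phi>: "bounded_functional S \<phi> C" and "finite F" "F \<subseteq> S"
  shows "\<phi> (restr F f) = (\<Sum>y\<in>F. f y * \<phi> (unit_vec y))" and "restr F f \<in> ell2 S"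
proof -
  have "\<phi> (restr F f) = (\<Sum>y\<in>F. f y * \<phi> (unit_vec y)) \<and> restr F f \<in> ell2 S"
    using assms(2,3)
  proof (induction F)
    case empty
    have "\<phi> (\<lambda>x. 0 * 0) = 0 * \<phi> (\<lambda>x. 0)"
      by (rule bounded_functionalD(2)[OF \<phi> ell2_zero])
    then show ?case by (simp add: restr_def)
  next
    case (insert y F)
    have e: "restr (insert y F) f = (\<lambda>x. f y * unit_vec y x + restr F f x)"
      using insert.hyps by (auto simp: restr_def unit_vec_def)
    have y: "unit_vec y \<in> ell2 S" and F: "restr F f \<in> ell2 S" using insert.IH insert.prems by auto
    have "\<phi> (restr (insert y F) f) = \<phi> (\<lambda>x. f y * unit_vec y x) + \<phi> (restr F f)"
      unfolding e by (rule bounded_functionalD(1)[OF \<phi> ell2_scale[OF y] F])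
    also have "\<phi> (\<lambda>x. f y * unit_vec y x) = f y * \<phi> (unit_vec y)"
      by (rule bounded_functionalD(2)[OF \<phi> y])
    moreover have "restr (insert y F) f \<in> ell2 S"
      unfolding e by (intro ell2_add ell2_scale y F)
    ultimately show ?case using insert by (simp only: sum.insert) auto
  qed
  then show "\<phi> (restr F f) = (\<Sum>y\<in>F. f y * \<phi> (unit_vec y))" "restr F f \<in> ell2 S" by auto
qed

text \<open>The difference between \<^term>\<open>\<phi> f\<close> and a finite partial sum is \<^term>\<open>\<phi>\<close> applied to the
  truncation error of \<^term>\<open>f\<close>. Coordinates of an operator and matrix coefficients of an operator are
  such functionals, so every later identity between operators can be checked on unit vectors.\<close>
lemma bounded_functional_expand:
  assumes \<phi>: "bounded_functional S \<phi> C" and f: "f \<in> ell2 S"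
  shows "((\<lambda>y. f y * \<phi> (unit_vec y)) has_sum \<phi> f) S"
proof -
  have d: "cmod ((\<Sum>y\<in>F. f y * \<phi> (unit_vec y)) - \<phi> f) \<le> C * ell2_norm S (\<lambda>x. f x - restr F f x)"
    if "finite F" "F \<subseteq> S" for F
  proof -
    note F = bounded_functional_finite[OF \<phi> that]
    have m: "(\<lambda>x. (-1) * restr F f x) \<in> ell2 S" using F(2) by (rule ell2_scale)
    have "\<phi> (\<lambda>x. f x + (-1) * restr F f x) = \<phi> f + \<phi> (\<lambda>x. (-1) * restr F f x)"
      by (rule bounded_functionalD(1)[OF \<phi> f m])
    also have "\<phi> (\<lambda>x. (-1) * restr F f x) = (-1) * \<phi> (restr F f)"
      by (rule bounded_functionalD(2)[OF \<phi> F(2)])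
    finally have "\<phi> (\<lambda>x. f x - restr F f x) = \<phi> f - (\<Sum>y\<in>F. f y * \<phi> (unit_vec y))"
      by (simp add: F(1))
    moreover have "cmod (\<phi> (\<lambda>x. f x - restr F f x)) \<le> C * ell2_norm S (\<lambda>x. f x - restr F f x)"
      by (rule bounded_functionalD(3)[OF \<phi> ell2_diff[OF f F(2)]])
    ultimately show ?thesis by (simp add: norm_minus_commute)
  qed
  have "((\<lambda>F. (\<Sum>y\<in>F. f y * \<phi> (unit_vec y)) - \<phi> f) \<longlongrightarrow> 0) (finite_subsets_at_top S)"
    by (rule tendsto_0_le[OF ell2_truncation_tendsto[OF f], where K = C])
       (use d in \<open>auto simp: eventually_finite_subsets_at_top mult.commute[of _ C] intro!: exI[of _ "{}"]\<close>)
  then show ?thesis unfolding has_sum_def by (simp add: LIM_zero_iff)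
qed

text \<open>The Riesz representation theorem, without completeness. Evaluating \<^term>\<open>\<phi>\<close> on a
  truncation of the candidate \<^term>\<open>g\<close> gives the square sum of that truncation, so the bound on
  \<^term>\<open>\<phi>\<close> says \<open>s \<le> C * sqrt s\<close> for every finite square sum \<open>s\<close>.\<close>
lemma bounded_functional_representative:
  assumes \<phi>: "bounded_functional S \<phi> C" and C: "0 \<le> C"
  defines "g \<equiv> \<lambda>y. if y \<in> S then cnj (\<phi> (unit_vec y)) else 0"
  shows "g \<in> ell2 S" and "ell2_norm S g \<le> C"
proof -
  have "L2_set (\<lambda>x. cmod (g x)) F \<le> C" if F: "finite F" "F \<subseteq> S" for F
  proof -
    note * = bounded_functional_finite[OF \<phi> F, of g]
    let ?s = "\<Sum>y\<in>F. (cmod (g y))\<^sup>2"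
    have nn: "0 \<le> ?s" by (simp add: sum_nonneg)
    have "\<phi> (restr F g) = (\<Sum>y\<in>F. of_real ((cmod (g y))\<^sup>2))"
      unfolding *(1) using F(2)
      by (intro sum.cong) (auto simp: g_def complex_norm_square mult.commute simp del: of_real_power)
    then have "\<phi> (restr F g) = of_real ?s" by simp
    then have "?s \<le> C * ell2_norm S (restr F g)"
      using bounded_functionalD(3)[OF \<phi> *(2)] nn by (metis norm_of_real abs_of_nonneg)
    moreover have "ell2_norm S (restr F g) = sqrt ?s"
      using F by (subst real_sqrt_unique) (auto simp: ell2_norm_restr_squared Int_absorb1)
    ultimately have "sqrt ?s * sqrt ?s \<le> C * sqrt ?s" using nn by simp
    then have "sqrt ?s \<le> C" using C nn
      by (metis mult_right_le_imp_le order_le_less real_sqrt_ge_zero)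
    then show ?thesis by (simp add: L2_set_def)
  qed
  then show "g \<in> ell2 S" "ell2_norm S g \<le> C"
    using L2_set_boundI[of S g C] C by (auto simp: g_def)
qed

section \<open>Bounded operators and their adjoints\<close>

lemma bounded_ops_values [simp]: "T \<in> bounded_ops S \<Longrightarrow> f \<in> ell2 S \<Longrightarrow> T f \<in> ell2 S"
  by (auto simp: bounded_ops_def)

lemma bounded_ops_linear:
  assumes "T \<in> bounded_ops S" "f \<in> ell2 S"
  shows "g \<in> ell2 S \<Longrightarrow> T (\<lambda>x. f x + g x) = (\<lambda>x. T f x + T g x)"
    and "T (\<lambda>x. c * f x) = (\<lambda>x. c * T f x)"
  using assms by (auto simp: bounded_ops_def)

lemma bounded_ops_diff:
  assumes "T \<in> bounded_ops S" "f \<in> ell2 S" "g \<in> ell2 S"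
  shows "T (\<lambda>x. f x - g x) = (\<lambda>x. T f x - T g x)"
  using bounded_ops_linear(1)[OF assms(1,2) ell2_scale[OF assms(3), of "-1"]]
    bounded_ops_linear(2)[OF assms(1,3), of "-1"] by simp

lemma bounded_ops_bound:
  assumes "T \<in> bounded_ops S"
  obtains K where "0 \<le> K" "\<And>f. f \<in> ell2 S \<Longrightarrow> ell2_norm S (T f) \<le> K * ell2_norm S f"
proof -
  obtain K where K: "\<forall>f\<in>ell2 S. ell2_norm S (T f) \<le> K * ell2_norm S f"
    using assms by (auto simp: bounded_ops_def)
  show ?thesis
  proof (rule that[of "max K 0"])
    show "ell2_norm S (T f) \<le> max K 0 * ell2_norm S f" if "f \<in> ell2 S" for f
      using K that mult_right_mono[of K "max K 0" "ell2_norm S f"] by force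
  qed simp
qed

lemma bounded_opsI:
  assumes "T \<in> extensional (ell2 S)"
    and "\<And>f. f \<in> ell2 S \<Longrightarrow> T f \<in> ell2 S"
    and "\<And>f g. f \<in> ell2 S \<Longrightarrow> g \<in> ell2 S \<Longrightarrow> T (\<lambda>x. f x + g x) = (\<lambda>x. T f x + T g x)"
    and "\<And>c f. f \<in> ell2 S \<Longrightarrow> T (\<lambda>x. c * f x) = (\<lambda>x. c * T f x)"
    and "\<And>f. f \<in> ell2 S \<Longrightarrow> ell2_norm S (T f) \<le> K * ell2_norm S f"
  shows "T \<in> bounded_ops S"
proof -
  have "\<exists>K. \<forall>f\<in>ell2 S. ell2_norm S (T f) \<le> K * ell2_norm S f" using assms(5) by blast
  then show ?thesis unfolding bounded_ops_def PiE_def Pi_def using assms(1-4) by blast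
qed

lemma bounded_ops_extensional: "T \<in> bounded_ops S \<Longrightarrow> T \<in> extensional (ell2 S)"
  unfolding bounded_ops_def PiE_def by blast

lemma op_eqI:
  assumes "T \<in> extensional (ell2 S)" "U \<in> extensional (ell2 S)"
    and "\<And>f. f \<in> ell2 S \<Longrightarrow> T f = U f"
  shows "T = U"
  using assms by (rule extensionalityI)

lemma op_apply [simp]:
  assumes "f \<in> ell2 S"
  shows "compose (ell2 S) T U f = T (U f)" "op_one S f = f"
    "op_add S T U f = (\<lambda>x. T f x + U f x)" "op_diff S T U f = (\<lambda>x. T f x - U f x)"
    "op_scale S c T f = (\<lambda>x. c * T f x)"
  using assms by (simp_all add: compose_def op_one_def op_add_def op_diff_def op_scale_def)

lemma op_extensional [simp]:
  "compose (ell2 S) T U \<in> extensional (ell2 S)" "op_one S \<in> extensional (ell2 S)"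
  "op_add S T U \<in> extensional (ell2 S)" "op_diff S T U \<in> extensional (ell2 S)"
  "op_scale S c T \<in> extensional (ell2 S)"
  by (simp_all add: compose_def op_one_def op_add_def op_diff_def op_scale_def)

lemma op_one_bounded [simp]: "op_one S \<in> bounded_ops S"
  by (rule bounded_opsI[where K = 1]) (auto simp: ell2_add ell2_scale)

lemma op_add_bounded [simp]:
  assumes T: "T \<in> bounded_ops S" and U: "U \<in> bounded_ops S"
  shows "op_add S T U \<in> bounded_ops S"
proof -
  obtain K where K: "\<And>f. f \<in> ell2 S \<Longrightarrow> ell2_norm S (T f) \<le> K * ell2_norm S f"
    using bounded_ops_bound[OF T] by blast
  obtain L where L: "\<And>f. f \<in> ell2 S \<Longrightarrow> ell2_norm S (U f) \<le> L * ell2_norm S f"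
    using bounded_ops_bound[OF U] by blast
  show ?thesis
  proof (rule bounded_opsI[where K = "K + L"])
    fix f assume f: "f \<in> ell2 S"
    have "ell2_norm S (op_add S T U f) \<le> ell2_norm S (T f) + ell2_norm S (U f)"
      using f T U by (simp add: ell2_norm_triangle)
    also have "\<dots> \<le> (K + L) * ell2_norm S f"
      using K[OF f] L[OF f] by (simp add: ring_distribs)
    finally show "ell2_norm S (op_add S T U f) \<le> (K + L) * ell2_norm S f" .
  qed (use T U in \<open>auto simp: ell2_add ell2_scale bounded_ops_linear ring_distribs\<close>)
qed

lemma op_scale_bounded [simp]:
  assumes T: "T \<in> bounded_ops S"
  shows "op_scale S c T \<in> bounded_ops S"
proof -
  obtain K where K: "\<And>f. f \<in> ell2 S \<Longrightarrow> ell2_norm S (T f) \<le> K * ell2_norm S f"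
    using bounded_ops_bound[OF T] by blast
  show ?thesis
  proof (rule bounded_opsI[where K = "cmod c * K"])
    show "ell2_norm S (op_scale S c T f) \<le> cmod c * K * ell2_norm S f" if f: "f \<in> ell2 S" for f
      using K[OF f] f by (simp add: ell2_norm_scale mult.assoc mult_left_mono)
  qed (use T in \<open>auto simp: ell2_add ell2_scale bounded_ops_linear ring_distribs mult_ac\<close>)
qed

lemma op_diff_eq:
  "op_diff S T U = op_add S T (op_scale S (-1) U)"
  by (rule op_eqI[where S = S]) auto

lemma op_diff_bounded [simp]:
  "T \<in> bounded_ops S \<Longrightarrow> U \<in> bounded_ops S \<Longrightarrow> op_diff S T U \<in> bounded_ops S"
  by (simp add: op_diff_eq)

lemma compose_bounded [simp]:
  assumes T: "T \<in> bounded_ops S" and U: "U \<in> bounded_ops S"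
  shows "compose (ell2 S) T U \<in> bounded_ops S"
proof -
  obtain K where K: "0 \<le> K" "\<And>f. f \<in> ell2 S \<Longrightarrow> ell2_norm S (T f) \<le> K * ell2_norm S f"
    using bounded_ops_bound[OF T] by blast
  obtain L where L: "\<And>f. f \<in> ell2 S \<Longrightarrow> ell2_norm S (U f) \<le> L * ell2_norm S f"
    using bounded_ops_bound[OF U] by blast
  show ?thesis
  proof (rule bounded_opsI[where K = "K * L"])
    fix f assume f: "f \<in> ell2 S"
    have "ell2_norm S (T (U f)) \<le> K * ell2_norm S (U f)" using K f U by simp
    also have "\<dots> \<le> K * (L * ell2_norm S f)" using K L[OF f] by (intro mult_left_mono) auto
    finally show "ell2_norm S (compose (ell2 S) T U f) \<le> K * L * ell2_norm S f"
      using f by (simp add: mult.assoc)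
  qed (use T U in \<open>auto simp: ell2_add ell2_scale bounded_ops_linear\<close>)
qed

lemma bounded_ops_matrix_expand:
  assumes T: "T \<in> bounded_ops S" and f: "f \<in> ell2 S"
  shows "((\<lambda>y. f y * T (unit_vec y) b) has_sum T f b) S"
proof -
  obtain K where K: "0 \<le> K" "\<And>f. f \<in> ell2 S \<Longrightarrow> ell2_norm S (T f) \<le> K * ell2_norm S f"
    using bounded_ops_bound[OF T] by blast
  have "bounded_functional S (\<lambda>f. T f b) K"
    unfolding bounded_functional_def
    using T order_trans[OF cmod_le_ell2_norm[OF bounded_ops_values[OF T]] K(2)]
    by (auto simp: bounded_ops_linear)
  then show ?thesis by (rule bounded_functional_expand[OF _ f])
qed

lemma bounded_op_finite_support_norm:
  assumes W: "W \<in> bounded_ops S" and F: "finite F" "F \<subseteq> S"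
    and le: "\<And>y. y \<in> F \<Longrightarrow> ell2_norm S (W (unit_vec y)) \<le> e"
  shows "restr F f \<in> ell2 S \<and> ell2_norm S (W (restr F f)) \<le> e * (\<Sum>y\<in>F. cmod (f y))"
  using F le
proof (induction F)
  case empty
  have "W (\<lambda>x. 0) = (\<lambda>x. 0)" using bounded_ops_linear(2)[OF W ell2_zero, of 0] by simp
  then show ?case by (simp add: restr_def)
next
  case (insert y F)
  have e: "restr (insert y F) f = (\<lambda>x. f y * unit_vec y x + restr F f x)"
    using insert.hyps by (auto simp: restr_def unit_vec_def)
  have IH: "restr F f \<in> ell2 S" "ell2_norm S (W (restr F f)) \<le> e * (\<Sum>y\<in>F. cmod (f y))"
    using insert by auto
  have y: "unit_vec y \<in> ell2 S" using insert.prems by simp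
  have "W (restr (insert y F) f) = (\<lambda>x. f y * W (unit_vec y) x + W (restr F f) x)"
    unfolding e using bounded_ops_linear(1)[OF W ell2_scale[OF y] IH(1)] bounded_ops_linear(2)[OF W y] by simp
  then have "ell2_norm S (W (restr (insert y F) f)) \<le> cmod (f y) * ell2_norm S (W (unit_vec y)) + ell2_norm S (W (restr F f))"
    using ell2_norm_triangle[OF ell2_scale[OF bounded_ops_values[OF W y]] bounded_ops_values[OF W IH(1)]]
    by (simp add: ell2_norm_scale)
  also have "\<dots> \<le> cmod (f y) * e + e * (\<Sum>y\<in>F. cmod (f y))"
    using insert.prems IH by (intro add_mono mult_left_mono) auto
  also have "\<dots> = e * (\<Sum>y\<in>insert y F. cmod (f y))"
    using insert.hyps by (simp add: ring_distribs mult.commute)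
  finally show ?case unfolding e using ell2_add[OF ell2_scale[OF y] IH(1)] by simp
qed

lemma op_eq_if_matrix_eq:
  assumes T: "T \<in> bounded_ops S" and U: "U \<in> bounded_ops S"
    and eq: "\<And>y b. y \<in> S \<Longrightarrow> b \<in> S \<Longrightarrow> T (unit_vec y) b = U (unit_vec y) b"
  shows "T = U"
proof (rule op_eqI[OF bounded_ops_extensional[OF T] bounded_ops_extensional[OF U]])
  fix f assume f: "f \<in> ell2 S"
  show "T f = U f"
  proof
    fix b
    have "((\<lambda>y. f y * T (unit_vec y) b) has_sum T f b) S \<longleftrightarrow>
          ((\<lambda>y. f y * U (unit_vec y) b) has_sum T f b) S"
    proof (intro has_sum_cong)
      fix y assume y: "y \<in> S"
      show "f y * T (unit_vec y) b = f y * U (unit_vec y) b"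
      proof (cases "b \<in> S")
        case False
        then show ?thesis
          using ell2_outside[OF bounded_ops_values[OF T unit_vec_ell2[OF y]] False]
            ell2_outside[OF bounded_ops_values[OF U unit_vec_ell2[OF y]] False] by simp
      qed (use y eq in simp)
    qed
    then have "((\<lambda>y. f y * U (unit_vec y) b) has_sum T f b) S"
      using bounded_ops_matrix_expand[OF T f] by blast
    then show "T f b = U f b" using bounded_ops_matrix_expand[OF U f] by (rule has_sum_unique)
  qed
qed

text \<open>The adjoint at \<^term>\<open>g\<close> represents the functional \<open>f \<mapsto> \<langle>T f, g\<rangle>\<close>; its coordinate at \<open>y\<close> is
  therefore \<open>\<langle>g, T \<delta>\<^sub>y\<rangle>\<close>, and linearity in \<^term>\<open>g\<close> is visible from this formula.\<close>
lemma op_adj_exists: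
  assumes T: "T \<in> bounded_ops S"
  shows "\<exists>U\<in>bounded_ops S. \<forall>f\<in>ell2 S. \<forall>g\<in>ell2 S. ell2_inner S (T f) g = ell2_inner S f (U g)"
proof -
  obtain K where K: "0 \<le> K" "\<And>f. f \<in> ell2 S \<Longrightarrow> ell2_norm S (T f) \<le> K * ell2_norm S f"
    using bounded_ops_bound[OF T] by blast
  define U where "U = (\<lambda>g\<in>ell2 S. \<lambda>y. if y \<in> S then ell2_inner S g (T (unit_vec y)) else 0)"
  have func: "bounded_functional S (\<lambda>f. ell2_inner S (T f) g) (K * ell2_norm S g)"
    if g: "g \<in> ell2 S" for g
  proof -
    have "cmod (ell2_inner S (T f) g) \<le> K * ell2_norm S g * ell2_norm S f" if f: "f \<in> ell2 S" for f
    proof -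
      have "cmod (ell2_inner S (T f) g) \<le> ell2_norm S (T f) * ell2_norm S g"
        using T f g by (intro Cauchy_Schwarz_ell2) auto
      also have "\<dots> \<le> K * ell2_norm S f * ell2_norm S g"
        using K(2)[OF f] by (intro mult_right_mono) auto
      finally show ?thesis by (simp add: mult_ac)
    qed
    then show ?thesis unfolding bounded_functional_def
      using T g by (auto simp: bounded_ops_linear ell2_inner_add_left ell2_inner_scale_left)
  qed
  have Ug: "U g = (\<lambda>y. if y \<in> S then cnj (ell2_inner S (T (unit_vec y)) g) else 0)"
    if "g \<in> ell2 S" for g
    using that by (auto simp: U_def ell2_inner_cnj)
  have rep: "U g \<in> ell2 S" "ell2_norm S (U g) \<le> K * ell2_norm S g" if g: "g \<in> ell2 S" for g
    using bounded_functional_representative[OF func[OF g]] K(1) by (simp_all add: Ug[OF g])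
  have "ell2_inner S (T f) g = ell2_inner S f (U g)" if f: "f \<in> ell2 S" and g: "g \<in> ell2 S" for f g
  proof -
    have "((\<lambda>y. f y * ell2_inner S (T (unit_vec y)) g) has_sum ell2_inner S (T f) g) S"
      by (rule bounded_functional_expand[OF func[OF g] f])
    then have "((\<lambda>y. f y * cnj (U g y)) has_sum ell2_inner S (T f) g) S"
      by (subst has_sum_cong[where g = "\<lambda>y. f y * ell2_inner S (T (unit_vec y)) g"]) (simp_all add: Ug[OF g])
    then show ?thesis unfolding ell2_inner_def[of S f] by (rule infsumI[symmetric])
  qed
  moreover have "U \<in> bounded_ops S"
  proof (rule bounded_opsI[where K = K])
    show "U \<in> extensional (ell2 S)" by (simp add: U_def)
    show "U (\<lambda>x. f x + g x) = (\<lambda>x. U f x + U g x)" if "f \<in> ell2 S" "g \<in> ell2 S" for f g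
      using that T by (auto simp: U_def ell2_add ell2_inner_add_left)
    show "U (\<lambda>x. c * f x) = (\<lambda>x. c * U f x)" if "f \<in> ell2 S" for c f
      using that by (auto simp: U_def ell2_scale ell2_inner_scale_left)
  qed (use rep in auto)
  ultimately show ?thesis by blast
qed

lemma op_adj_eqI:
  assumes U: "U \<in> bounded_ops S"
    and adj: "\<And>f g. f \<in> ell2 S \<Longrightarrow> g \<in> ell2 S \<Longrightarrow> ell2_inner S (T f) g = ell2_inner S f (U g)"
  shows "op_adj S T = U"
  unfolding op_adj_def
proof (rule the_equality)
  show "U \<in> bounded_ops S \<and> (\<forall>f\<in>ell2 S. \<forall>g\<in>ell2 S. ell2_inner S (T f) g = ell2_inner S f (U g))"
    using assms by blast
next
  fix V
  assume V: "V \<in> bounded_ops S \<and> (\<forall>f\<in>ell2 S. \<forall>g\<in>ell2 S. ell2_inner S (T f) g = ell2_inner S f (V g))"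
  have "cnj (V g b) = cnj (U g b)" if "g \<in> ell2 S" "b \<in> S" for g b
    using V that adj[of "unit_vec b" g] ell2_inner_unit_vec_left[OF that(2)]
    by (metis unit_vec_ell2)
  then show "V = U" using V U by (intro op_eq_if_matrix_eq) auto
qed

text \<open>The defining description of \<^const>\<open>op_adj\<close> determines a unique operator: testing against a unit
  vector recovers each coordinate of the adjoint.\<close>
lemma op_adj_characterization:
  assumes "T \<in> bounded_ops S"
  shows op_adj_bounded [simp]: "op_adj S T \<in> bounded_ops S"
    and op_adj_inner: "f \<in> ell2 S \<Longrightarrow> g \<in> ell2 S \<Longrightarrow> ell2_inner S (T f) g = ell2_inner S f (op_adj S T g)"
proof -
  obtain U where "U \<in> bounded_ops S" "\<forall>f\<in>ell2 S. \<forall>g\<in>ell2 S. ell2_inner S (T f) g = ell2_inner S f (U g)"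
    using op_adj_exists[OF assms] by blast
  moreover then have "op_adj S T = U" by (intro op_adj_eqI) auto
  ultimately show "op_adj S T \<in> bounded_ops S"
    "f \<in> ell2 S \<Longrightarrow> g \<in> ell2 S \<Longrightarrow> ell2_inner S (T f) g = ell2_inner S f (op_adj S T g)"
    by auto
qed

lemma op_adj_inner':
  assumes "T \<in> bounded_ops S" "f \<in> ell2 S" "g \<in> ell2 S"
  shows "ell2_inner S (op_adj S T f) g = ell2_inner S f (T g)"
  using op_adj_inner[OF assms(1,3,2)] by (metis ell2_inner_cnj)

lemma op_adj_op_adj: "T \<in> bounded_ops S \<Longrightarrow> op_adj S (op_adj S T) = T"
  by (rule op_adj_eqI) (auto simp: op_adj_inner')

lemma op_adj_compose:
  assumes "T \<in> bounded_ops S" "U \<in> bounded_ops S"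
  shows "op_adj S (compose (ell2 S) T U) = compose (ell2 S) (op_adj S U) (op_adj S T)"
  using assms by (intro op_adj_eqI) (auto simp: op_adj_inner)

lemma op_adj_matrix:
  assumes "T \<in> bounded_ops S" "y \<in> S" "b \<in> S"
  shows "op_adj S T (unit_vec y) b = cnj (T (unit_vec b) y)"
  using op_adj_inner'[OF assms(1), of "unit_vec y" "unit_vec b"] assms
  by (simp add: ell2_inner_unit_vec_left ell2_inner_unit_vec_right)

lemma op_norm_bound:
  assumes T: "T \<in> bounded_ops S" and f: "f \<in> ell2 S" "ell2_norm S f \<le> 1"
  shows "ell2_norm S (T f) \<le> op_norm S T"
proof -
  obtain K where K: "0 \<le> K" "\<And>f. f \<in> ell2 S \<Longrightarrow> ell2_norm S (T f) \<le> K * ell2_norm S f"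
    using bounded_ops_bound[OF T] by blast
  have "ell2_norm S (T g) \<le> K" if "g \<in> ell2 S" "ell2_norm S g \<le> 1" for g
    using K(2)[OF that(1)] mult_left_mono[OF that(2) K(1)] by simp
  then show ?thesis unfolding op_norm_def
    by (intro cSUP_upper) (use f in \<open>auto intro!: bdd_aboveI2\<close>)
qed

lemma op_norm_leI:
  assumes "\<And>f. f \<in> ell2 S \<Longrightarrow> ell2_norm S f \<le> 1 \<Longrightarrow> ell2_norm S (T f) \<le> B"
  shows "op_norm S T \<le> B"
  unfolding op_norm_def by (rule cSUP_least) (use assms in \<open>auto intro: exI[of _ "\<lambda>x. 0"]\<close>)

lemma isometry_if_adj_left_inverse:
  assumes u: "u \<in> bounded_ops S" and "compose (ell2 S) (op_adj S u) u = op_one S" and f: "f \<in> ell2 S"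
  shows "ell2_norm S (u f) = ell2_norm S f"
proof -
  have "op_adj S u (u f) = f" using assms by (metis op_apply(1,2))
  then have "ell2_inner S (u f) (u f) = ell2_inner S f f"
    using op_adj_inner[OF u f, of "u f"] u f by simp
  then have "(ell2_norm S (u f))\<^sup>2 = (ell2_norm S f)\<^sup>2"
    using u f unfolding ell2_inner_self[OF f] ell2_inner_self[OF bounded_ops_values[OF u f]]
    using of_real_eq_iff by blast
  then show ?thesis by (simp add: power2_eq_iff_nonneg)
qed

lemma unitaries_props:
  assumes "u \<in> unitaries S M" "M \<subseteq> bounded_ops S"
  shows "u \<in> M" "u \<in> bounded_ops S"
    and "f \<in> ell2 S \<Longrightarrow> op_adj S u (u f) = f" and "f \<in> ell2 S \<Longrightarrow> u (op_adj S u f) = f"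
proof -
  show "u \<in> M" "u \<in> bounded_ops S" using assms by (auto simp: unitaries_def)
  have "compose (ell2 S) (op_adj S u) u = op_one S" "compose (ell2 S) u (op_adj S u) = op_one S"
    using assms by (auto simp: unitaries_def)
  then show "f \<in> ell2 S \<Longrightarrow> op_adj S u (u f) = f" "f \<in> ell2 S \<Longrightarrow> u (op_adj S u f) = f"
    by (metis op_apply(1,2))+
qed

lemma unitary_norm:
  assumes "u \<in> unitaries S M" "M \<subseteq> bounded_ops S" "f \<in> ell2 S"
  shows "ell2_norm S (u f) = ell2_norm S f" "ell2_norm S (op_adj S u f) = ell2_norm S f"
proof -
  have u: "u \<in> bounded_ops S" using assms by (auto simp: unitaries_def)
  show "ell2_norm S (u f) = ell2_norm S f"
    by (rule isometry_if_adj_left_inverse[OF u _ assms(3)]) (use assms in \<open>auto simp: unitaries_def\<close>)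
  show "ell2_norm S (op_adj S u f) = ell2_norm S f"
    by (rule isometry_if_adj_left_inverse[OF op_adj_bounded[OF u] _ assms(3)])
       (use assms in \<open>auto simp: unitaries_def op_adj_op_adj[OF u]\<close>)
qed

lemma op_conj_apply:
  "f \<in> ell2 S \<Longrightarrow> op_adj S u f \<in> ell2 S \<Longrightarrow> op_conj S u a f = u (a (op_adj S u f))"
  by (simp add: op_conj_def)

lemma op_conj_bounded:
  "u \<in> bounded_ops S \<Longrightarrow> a \<in> bounded_ops S \<Longrightarrow> op_conj S u a \<in> bounded_ops S"
  by (simp add: op_conj_def)

lemma op_conj_extensional [simp]: "op_conj S u a \<in> extensional (ell2 S)"
  by (simp add: op_conj_def)

lemma op_adj_op_conj:
  assumes u: "u \<in> bounded_ops S" and a: "a \<in> bounded_ops S"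
  shows "op_adj S (op_conj S u a) = op_conj S u (op_adj S a)"
proof -
  have "op_adj S (op_conj S u a) = compose (ell2 S) (compose (ell2 S) u (op_adj S a)) (op_adj S u)"
    using assms by (simp add: op_conj_def op_adj_compose op_adj_op_adj)
  also have "\<dots> = op_conj S u (op_adj S a)"
    by (rule op_eqI[where S = S]) (use assms in \<open>auto simp: op_conj_def\<close>)
  finally show ?thesis .
qed

section \<open>Commutants\<close>

lemma commutant_bounded: "T \<in> commutant S X \<Longrightarrow> T \<in> bounded_ops S"
  by (simp add: commutant_def)

lemma commutantD:
  assumes "T \<in> commutant S X" "U \<in> X" "f \<in> ell2 S"
  shows "T (U f) = U (T f)"
proof -
  have "compose (ell2 S) T U f = compose (ell2 S) U T f"
    using assms by (simp add: commutant_def)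
  then show ?thesis using assms(3) by simp
qed

lemma commutantI:
  assumes "T \<in> bounded_ops S" "\<And>U f. U \<in> X \<Longrightarrow> f \<in> ell2 S \<Longrightarrow> T (U f) = U (T f)"
  shows "T \<in> commutant S X"
  unfolding commutant_def using assms by (auto intro!: op_eqI[where S = S])

lemma commutant_antimono: "X \<subseteq> Y \<Longrightarrow> commutant S Y \<subseteq> commutant S X"
  by (auto simp: commutant_def)

lemma subset_double_commutant: "X \<subseteq> bounded_ops S \<Longrightarrow> X \<subseteq> commutant S (commutant S X)"
  by (auto simp: commutant_def)

lemma triple_commutant:
  assumes "X \<subseteq> bounded_ops S"
  shows "commutant S (commutant S (commutant S X)) = commutant S X"
proof
  show "commutant S (commutant S (commutant S X)) \<subseteq> commutant S X"
    by (rule commutant_antimono[OF subset_double_commutant[OF assms]])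
  show "commutant S X \<subseteq> commutant S (commutant S (commutant S X))"
    by (rule subset_double_commutant) (auto simp: commutant_def)
qed

lemma commutant_closed:
  assumes X: "X \<subseteq> bounded_ops S"
  shows commutant_one: "op_one S \<in> commutant S X"
    and commutant_compose: "T \<in> commutant S X \<Longrightarrow> U \<in> commutant S X \<Longrightarrow> compose (ell2 S) T U \<in> commutant S X"
    and commutant_add: "T \<in> commutant S X \<Longrightarrow> U \<in> commutant S X \<Longrightarrow> op_add S T U \<in> commutant S X"
    and commutant_scale: "T \<in> commutant S X \<Longrightarrow> op_scale S c T \<in> commutant S X"
    and commutant_diff: "T \<in> commutant S X \<Longrightarrow> U \<in> commutant S X \<Longrightarrow> op_diff S T U \<in> commutant S X"
proof -
  show one: "op_one S \<in> commutant S X"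
    using X by (intro commutantI) (auto dest: bounded_ops_values)
  show "compose (ell2 S) T U \<in> commutant S X" if "T \<in> commutant S X" "U \<in> commutant S X"
  proof (rule commutantI)
    fix V f assume V: "V \<in> X" and f: "f \<in> ell2 S"
    note * = commutantD[OF that(1) V] commutantD[OF that(2) V] commutant_bounded[OF that(1)]
      commutant_bounded[OF that(2)] subsetD[OF X V]
    show "compose (ell2 S) T U (V f) = V (compose (ell2 S) T U f)"
      using * f by simp
  qed (use that commutant_bounded in \<open>blast intro: compose_bounded\<close>)
  show add: "op_add S T U \<in> commutant S X" if "T \<in> commutant S X" "U \<in> commutant S X" for T U
  proof (rule commutantI)
    fix V f assume V: "V \<in> X" and f: "f \<in> ell2 S"
    note * = commutantD[OF that(1) V] commutantD[OF that(2) V] commutant_bounded[OF that(1)]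
      commutant_bounded[OF that(2)] subsetD[OF X V]
    show "op_add S T U (V f) = V (op_add S T U f)"
      using * f by (simp add: bounded_ops_linear)
  qed (use that commutant_bounded in \<open>blast intro: op_add_bounded\<close>)
  show scale: "op_scale S c T \<in> commutant S X" if "T \<in> commutant S X" for T c
  proof (rule commutantI)
    fix V f assume V: "V \<in> X" and f: "f \<in> ell2 S"
    note * = commutantD[OF that(1) V] commutant_bounded[OF that(1)] subsetD[OF X V]
    show "op_scale S c T (V f) = V (op_scale S c T f)"
      using * f by (simp add: bounded_ops_linear)
  qed (use that commutant_bounded in \<open>blast intro: op_scale_bounded\<close>)
  show "op_diff S T U \<in> commutant S X" if "T \<in> commutant S X" "U \<in> commutant S X"
    using add[OF that(1) scale[OF that(2)]] by (simp add: op_diff_eq)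
qed

text \<open>Every von Neumann algebra containing \<^term>\<open>X\<close> equals its own bicommutant and hence contains that
  of \<^term>\<open>X\<close>. Only closure under adjoints is not automatic, so it stays as a hypothesis.\<close>
lemma vn_generated_eq_double_commutant:
  assumes X: "X \<subseteq> bounded_ops S"
    and adj: "\<And>T. T \<in> commutant S (commutant S X) \<Longrightarrow> op_adj S T \<in> commutant S (commutant S X)"
  shows "vn_generated S X = commutant S (commutant S X)"
    and "von_neumann_algebra S (commutant S (commutant S X))"
proof -
  have b: "commutant S X \<subseteq> bounded_ops S" by (auto simp: commutant_def)
  show vn: "von_neumann_algebra S (commutant S (commutant S X))"
    unfolding von_neumann_algebra_def using adj triple_commutant[OF b] by blast
  have "commutant S (commutant S X) \<subseteq> M" if "von_neumann_algebra S M" "X \<subseteq> M" for M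
    using that(1) commutant_antimono[OF commutant_antimono[OF that(2)], of S S]
    by (simp add: von_neumann_algebra_def)
  then show "vn_generated S X = commutant S (commutant S X)"
    unfolding vn_generated_def using vn subset_double_commutant[OF X] by blast
qed

section \<open>Block diagonal compressions\<close>

text \<open>The function \<^term>\<open>k\<close> labels the coordinates. Matrix entries between coordinates with different labels
  are deleted and all others are kept, which is \<open>\<Sum>\<^sub>c P\<^sub>c T P\<^sub>c\<close> for the coordinate projections \<open>P\<^sub>c\<close> onto
  the blocks. Written coordinatewise, the sum over possibly uncountably many blocks needs no
  convergence argument.\<close>
definition block_diag :: "'a set \<Rightarrow> ('a \<Rightarrow> 'k) \<Rightarrow> 'a op \<Rightarrow> 'a op" where
  "block_diag S k T = (\<lambda>f\<in>ell2 S. \<lambda>b. T (restr {y. k y = k b} f) b)"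

lemma sum_blocks_le:
  assumes f: "f \<in> ell2 S" and I: "finite I"
  shows "(\<Sum>c\<in>I. (ell2_norm S (restr {y. k y = c} f))\<^sup>2) \<le> (ell2_norm S f)\<^sup>2"
proof -
  have s: "(\<lambda>x. (cmod (f x))\<^sup>2) summable_on S" using f by (rule ell2_summable)
  have "(\<Sum>c\<in>I. (ell2_norm S (restr {y. k y = c} f))\<^sup>2)
      = (\<Sum>c\<in>I. \<Sum>\<^sub>\<infinity>x\<in>S \<inter> {y. k y = c}. (cmod (f x))\<^sup>2)"
    by (simp add: ell2_norm_restr_squared)
  also have "\<dots> = (\<Sum>\<^sub>\<infinity>x\<in>(\<Union>c\<in>I. S \<inter> {y. k y = c}). (cmod (f x))\<^sup>2)"
    by (rule sum_infsum[OF I]) (auto intro: summable_on_subset_banach[OF s])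
  also have "\<dots> \<le> (\<Sum>\<^sub>\<infinity>x\<in>S. (cmod (f x))\<^sup>2)"
    by (rule infsum_mono2) (auto intro: summable_on_subset_banach[OF s] s)
  finally show ?thesis by (simp add: ell2_norm_squared)
qed

text \<open>On each block the compression is bounded by the bound of \<^term>\<open>T\<close>; the blocks are orthogonal, so
  these estimates add up in squares.\<close>
lemma block_diag_bounded:
  assumes T: "T \<in> bounded_ops S"
  shows "block_diag S k T \<in> bounded_ops S"
proof -
  obtain K where K: "0 \<le> K" "\<And>f. f \<in> ell2 S \<Longrightarrow> ell2_norm S (T f) \<le> K * ell2_norm S f"
    using bounded_ops_bound[OF T] by blast
  let ?D = "block_diag S k T"
  have D: "?D f = (\<lambda>b. T (restr {y. k y = k b} f) b)" if "f \<in> ell2 S" for f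
    using that by (simp add: block_diag_def)
  have main: "?D f \<in> ell2 S \<and> ell2_norm S (?D f) \<le> K * ell2_norm S f" if f: "f \<in> ell2 S" for f
  proof -
    let ?r = "\<lambda>c. restr {y. k y = c} f"
    have r: "?r c \<in> ell2 S" for c using f by (rule restr_ell2)
    have "(\<Sum>b\<in>F. (cmod (?D f b))\<^sup>2) \<le> (K * ell2_norm S f)\<^sup>2" if F: "finite F" "F \<subseteq> S" for F
    proof -
      have "(\<Sum>b\<in>F. (cmod (?D f b))\<^sup>2) = (\<Sum>c\<in>k ` F. \<Sum>b\<in>{b \<in> F. k b = c}. (cmod (?D f b))\<^sup>2)"
        by (rule sum.image_gen[OF F(1)])
      also have "\<dots> = (\<Sum>c\<in>k ` F. \<Sum>b\<in>{b \<in> F. k b = c}. (cmod (T (?r c) b))\<^sup>2)"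
        using f by (intro sum.cong refl) (auto simp: D)
      also have "\<dots> \<le> (\<Sum>c\<in>k ` F. (K * ell2_norm S (?r c))\<^sup>2)"
      proof (rule sum_mono)
        fix c assume "c \<in> k ` F"
        have "(\<Sum>b\<in>{b \<in> F. k b = c}. (cmod (T (?r c) b))\<^sup>2) \<le> (ell2_norm S (T (?r c)))\<^sup>2"
          using F T r by (intro finite_sum_le_ell2_norm) auto
        also have "\<dots> \<le> (K * ell2_norm S (?r c))\<^sup>2"
          using K r by (intro power_mono) auto
        finally show "(\<Sum>b\<in>{b \<in> F. k b = c}. (cmod (T (?r c) b))\<^sup>2) \<le> (K * ell2_norm S (?r c))\<^sup>2" .
      qed
      also have "\<dots> = K\<^sup>2 * (\<Sum>c\<in>k ` F. (ell2_norm S (?r c))\<^sup>2)"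
        by (simp add: power_mult_distrib sum_distrib_left)
      also have "\<dots> \<le> K\<^sup>2 * (ell2_norm S f)\<^sup>2"
        using sum_blocks_le[OF f, of "k ` F" k] F by (intro mult_left_mono) auto
      finally show ?thesis by (simp add: power_mult_distrib)
    qed
    moreover have "?D f x = 0" if "x \<notin> S" for x
      using ell2_outside[OF bounded_ops_values[OF T r] that] by (simp add: D[OF f])
    ultimately show ?thesis using K(1) ell2_boundI[of S "?D f" "K * ell2_norm S f"] by simp
  qed
  show ?thesis
  proof (rule bounded_opsI[where K = K])
    show "?D \<in> extensional (ell2 S)" by (simp add: block_diag_def)
    show "?D (\<lambda>x. f x + g x) = (\<lambda>x. ?D f x + ?D g x)" if "f \<in> ell2 S" "g \<in> ell2 S" for f g
      using that T by (simp add: D ell2_add restr_add bounded_ops_linear restr_ell2)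
    show "?D (\<lambda>x. c * f x) = (\<lambda>x. c * ?D f x)" if "f \<in> ell2 S" for c f
      using that T by (simp add: D ell2_scale restr_scale bounded_ops_linear restr_ell2)
  qed (use main in auto)
qed

text \<open>The quadratic form of the compression at \<^term>\<open>f\<close> is the sum over the blocks of the form of
  \<^term>\<open>T\<close> at the restriction of \<^term>\<open>f\<close> to the block.\<close>
lemma block_diag_positive:
  assumes T: "op_positive S T"
  shows "op_positive S (block_diag S k T)"
proof -
  let ?D = "block_diag S k T"
  have Tb: "T \<in> bounded_ops S" using T by (simp add: op_positive_def)
  have "ell2_inner S (?D f) f \<in> \<real>\<^sub>\<ge>\<^sub>0" if f: "f \<in> ell2 S" for f
  proof -
    let ?r = "\<lambda>c. restr {y. k y = c} f"
    let ?B = "\<lambda>c. {b \<in> S. k b = c}"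
    have r: "?r c \<in> ell2 S" for c using f by (rule restr_ell2)
    have "bij_betw snd (Sigma (k ` S) ?B) S"
      by (rule bij_betwI[where g = "\<lambda>b. (k b, b)"]) auto
    then have S: "((\<lambda>p. ?D f (snd p) * cnj (f (snd p))) has_sum ell2_inner S (?D f) f) (Sigma (k ` S) ?B)"
      using ell2_inner_has_sum(1)[OF bounded_ops_values[OF block_diag_bounded[OF Tb] f] f]
      by (subst has_sum_reindex_bij_betw)
    have "((\<lambda>b. ?D f (snd (c, b)) * cnj (f (snd (c, b)))) has_sum ell2_inner S (T (?r c)) (?r c)) (?B c)" for c
    proof -
      have "((\<lambda>b. T (?r c) b * cnj (?r c b)) has_sum ell2_inner S (T (?r c)) (?r c)) S"
        using Tb r by (intro ell2_inner_has_sum(1)) auto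
      then show ?thesis
        by (rule has_sum_cong_neutral[THEN iffD1, rotated -1])
           (use f in \<open>auto simp: block_diag_def\<close>)
    qed
    then have h: "((\<lambda>c. ell2_inner S (T (?r c)) (?r c)) has_sum ell2_inner S (?D f) f) (k ` S)"
      by (intro has_sum_SigmaD[where f = "\<lambda>p. ?D f (snd p) * cnj (f (snd p))", OF S])
    have pos: "ell2_inner S (T (?r c)) (?r c) \<in> \<real>\<^sub>\<ge>\<^sub>0" for c
      using T r by (simp add: op_positive_def)
    have "0 \<le> Re (ell2_inner S (?D f) f)"
      by (rule has_sum_nonneg[OF has_sum_Re[OF h]]) (use pos in \<open>auto simp: complex_nonneg_Reals_iff\<close>)
    moreover have "Im (ell2_inner S (?D f) f) = 0"
      by (rule has_sum_unique[OF has_sum_Im[OF h]]) (use pos in \<open>auto simp: complex_nonneg_Reals_iff intro!: has_sum_0\<close>)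
    ultimately show ?thesis by (simp add: complex_nonneg_Reals_iff)
  qed
  then show ?thesis using block_diag_bounded[OF Tb] by (simp add: op_positive_def)
qed

section \<open>The von Neumann algebra of a subgroup\<close>

text \<open>Left and right translations are both of this form, and isometries for the same reason: a bijection
  reindexes the square sum.\<close>
definition perm_op :: "'a set \<Rightarrow> ('a \<Rightarrow> 'a) \<Rightarrow> 'a op" where
  "perm_op S p = (\<lambda>f\<in>ell2 S. \<lambda>x. if x \<in> S then f (p x) else 0)"

lemma perm_op_isometry:
  assumes p: "bij_betw p S S"
  shows perm_op_bounded: "perm_op S p \<in> bounded_ops S"
    and perm_op_norm: "f \<in> ell2 S \<Longrightarrow> ell2_norm S (perm_op S p f) = ell2_norm S f"
proof -
  have pS: "p x \<in> S" if "x \<in> S" for x using p that by (auto simp: bij_betw_def)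
  have e: "(cmod (if x \<in> S then f (p x) else 0))\<^sup>2 = (cmod (f (p x)))\<^sup>2" if "x \<in> S"
    for x and f :: "'a vec" using that by simp
  have mem: "perm_op S p f \<in> ell2 S" if f: "f \<in> ell2 S" for f
    using f summable_on_reindex_bij_betw[OF p, of "\<lambda>x. (cmod (f x))\<^sup>2"]
    by (simp add: perm_op_def ell2_def e cong: summable_on_cong)
  show norm: "ell2_norm S (perm_op S p f) = ell2_norm S f" if f: "f \<in> ell2 S" for f
    using f infsum_reindex_bij_betw[OF p, of "\<lambda>x. (cmod (f x))\<^sup>2"]
    by (simp add: perm_op_def ell2_norm_def e cong: infsum_cong)
  show "perm_op S p \<in> bounded_ops S"
  proof (rule bounded_opsI[where K = 1])
    show "perm_op S p (\<lambda>x. f x + g x) = (\<lambda>x. perm_op S p f x + perm_op S p g x)"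
      if "f \<in> ell2 S" "g \<in> ell2 S" for f g
      using that by (auto simp: perm_op_def ell2_add)
    show "perm_op S p (\<lambda>x. c * f x) = (\<lambda>x. c * perm_op S p f x)" if "f \<in> ell2 S" for c f
      using that by (auto simp: perm_op_def ell2_scale)
  qed (use mem norm in \<open>auto simp: perm_op_def\<close>)
qed

definition restr_op :: "'a set \<Rightarrow> 'a set \<Rightarrow> 'a op" where
  "restr_op S C = (\<lambda>f\<in>ell2 S. restr C f)"

lemma restr_op_bounded: "restr_op S C \<in> bounded_ops S"
  by (rule bounded_opsI[where K = 1])
     (auto simp: restr_op_def restr_ell2 ell2_add ell2_scale restr_add restr_scale)

context group
begin

lemma left_regular_perm_op: "left_regular G g = perm_op (carrier G) (\<lambda>x. inv g \<otimes> x)"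
  by (simp add: left_regular_def perm_op_def)

lemma bij_left_mult: "g \<in> carrier G \<Longrightarrow> bij_betw (\<lambda>x. g \<otimes> x) (carrier G) (carrier G)"
  by (rule bij_betwI[where g = "\<lambda>x. inv g \<otimes> x"]) (auto simp: m_assoc[symmetric])

lemma bij_right_mult: "g \<in> carrier G \<Longrightarrow> bij_betw (\<lambda>x. x \<otimes> g) (carrier G) (carrier G)"
  by (rule bij_betwI[where g = "\<lambda>x. x \<otimes> inv g"]) (auto simp: m_assoc)

lemma bij_inv: "bij_betw (\<lambda>x. inv x) (carrier G) (carrier G)"
  by (rule bij_betwI[where g = "\<lambda>x. inv x"]) auto

lemma left_regular_isometry:
  assumes "g \<in> carrier G"
  shows left_regular_bounded: "left_regular G g \<in> bounded_ops (carrier G)"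
    and left_regular_norm: "f \<in> ell2 (carrier G) \<Longrightarrow>
      ell2_norm (carrier G) (left_regular G g f) = ell2_norm (carrier G) f"
  unfolding left_regular_perm_op using assms by (auto intro!: perm_op_isometry bij_left_mult)

lemma left_regular_unit_vec:
  assumes "g \<in> carrier G" "y \<in> carrier G"
  shows "left_regular G g (unit_vec y) = unit_vec (g \<otimes> y)"
proof -
  have "inv g \<otimes> x = y \<longleftrightarrow> x = g \<otimes> y" if "x \<in> carrier G" for x
    using assms that by (metis inv_solve_left)
  moreover have "g \<otimes> y \<in> carrier G" using assms by simp
  moreover have "unit_vec y \<in> ell2 (carrier G)" using assms by simp
  ultimately show ?thesis by (auto simp: left_regular_def unit_vec_def)
qed

text \<open>The matrix condition says that the operator is left convolution by the vector \<open>T \<delta>\<^sub>1\<close>. It is stated on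
  unit vectors only, because then membership of products, adjoints and compressions is a
  computation with matrix entries.\<close>
definition convolution_ops :: "'a set \<Rightarrow> 'a op set" where
  "convolution_ops H = {T \<in> bounded_ops (carrier G).
     (\<forall>y\<in>carrier G. \<forall>b\<in>carrier G. T (unit_vec y) b = T (unit_vec \<one>) (b \<otimes> inv y)) \<and>
     (\<forall>x\<in>carrier G - H. T (unit_vec \<one>) x = 0)}"

lemma convolution_ops_bounded: "T \<in> convolution_ops H \<Longrightarrow> T \<in> bounded_ops (carrier G)"
  unfolding convolution_ops_def by blast

lemma convolution_ops_matrix:
  "T \<in> convolution_ops H \<Longrightarrow> y \<in> carrier G \<Longrightarrow> b \<in> carrier G \<Longrightarrow>
     T (unit_vec y) b = T (unit_vec \<one>) (b \<otimes> inv y)"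
  unfolding convolution_ops_def by blast

lemma convolution_ops_support:
  "T \<in> convolution_ops H \<Longrightarrow> x \<in> carrier G \<Longrightarrow> x \<notin> H \<Longrightarrow> T (unit_vec \<one>) x = 0"
  unfolding convolution_ops_def by blast

lemma convolution_opsI:
  assumes "T \<in> bounded_ops (carrier G)"
    and "\<And>y b. y \<in> carrier G \<Longrightarrow> b \<in> carrier G \<Longrightarrow>
      T (unit_vec y) b = T (unit_vec \<one>) (b \<otimes> inv y)"
    and "\<And>x. x \<in> carrier G \<Longrightarrow> x \<notin> H \<Longrightarrow> T (unit_vec \<one>) x = 0"
  shows "T \<in> convolution_ops H"
  unfolding convolution_ops_def using assms by blast

text \<open>Left translation by an element of \<^term>\<open>H\<close> maps \<^term>\<open>H\<close> onto itself.\<close>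
lemma restr_in_commutant_left_regular:
  assumes H: "subgroup H G"
  shows "restr_op (carrier G) H \<in> commutant (carrier G) (left_regular G ` H)"
proof (rule commutantI[OF restr_op_bounded])
  fix U f assume U: "U \<in> left_regular G ` H" and f: "f \<in> ell2 (carrier G)"
  then obtain h where h: "h \<in> H" "U = left_regular G h" by blast
  have hG: "h \<in> carrier G" using subgroup.mem_carrier[OF H h(1)] .
  have "inv h \<otimes> x \<in> H \<longleftrightarrow> x \<in> H" if "x \<in> carrier G" for x
  proof
    assume "inv h \<otimes> x \<in> H"
    then have "h \<otimes> (inv h \<otimes> x) \<in> H" by (rule subgroup.m_closed[OF H h(1)])
    then show "x \<in> H" using hG that by (simp add: m_assoc[symmetric])
  qed (use H h in \<open>auto simp: subgroup.m_closed subgroup.m_inv_closed\<close>)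
  moreover have "left_regular G h f \<in> ell2 (carrier G)"
    using left_regular_bounded[OF hG] f by simp
  moreover have "restr H f \<in> ell2 (carrier G)" using f by (rule restr_ell2)
  ultimately show "restr_op (carrier G) H (U f) = U (restr_op (carrier G) H f)"
    using f by (auto simp: restr_op_def h left_regular_def restr_def)
qed

lemma right_translation_in_commutant_left_regular:
  assumes H: "H \<subseteq> carrier G" and g: "g \<in> carrier G"
  shows "perm_op (carrier G) (\<lambda>x. x \<otimes> g) \<in> commutant (carrier G) (left_regular G ` H)"
proof (rule commutantI[OF perm_op_bounded[OF bij_right_mult[OF g]]])
  fix U f assume U: "U \<in> left_regular G ` H" and f: "f \<in> ell2 (carrier G)"
  then obtain h where h: "h \<in> carrier G" "U = left_regular G h" using H by blast
  have "left_regular G h f \<in> ell2 (carrier G)" "perm_op (carrier G) (\<lambda>x. x \<otimes> g) f \<in> ell2 (carrier G)"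
    using left_regular_bounded[OF h(1)] perm_op_bounded[OF bij_right_mult[OF g]] f by auto
  then show "perm_op (carrier G) (\<lambda>x. x \<otimes> g) (U f) = U (perm_op (carrier G) (\<lambda>x. x \<otimes> g) f)"
    using f g h(1) by (auto simp: h(2) left_regular_def perm_op_def m_assoc)
qed

lemma left_regular_subset_bounded: "H \<subseteq> carrier G \<Longrightarrow> left_regular G ` H \<subseteq> bounded_ops (carrier G)"
  using left_regular_bounded by auto

text \<open>Let \<open>\<xi> = T \<delta>\<^sub>1\<close>. Formally \<open>T = \<Sum>\<^sub>h \<xi>(h) \<lambda>\<^sub>h\<close> over \<open>h \<in> H\<close>, and \<^term>\<open>V\<close> commutes with every
  \<open>\<lambda>\<^sub>h\<close>. The series need not converge in norm, but its matrix coefficients do: both products have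
  the entry \<open>\<Sum>\<^sub>h \<xi>(h) (V \<delta>\<^sub>a)(h\<^sup>-\<^sup>1b)\<close> at \<open>(a, b)\<close>.\<close>
lemma convolution_ops_commute_commutant:
  assumes H: "subgroup H G" and T: "T \<in> convolution_ops H"
    and V: "V \<in> commutant (carrier G) (left_regular G ` H)"
  shows "compose (ell2 (carrier G)) T V = compose (ell2 (carrier G)) V T"
proof (rule op_eq_if_matrix_eq)
  let ?S = "carrier G"
  have Tb: "T \<in> bounded_ops ?S" and Vb: "V \<in> bounded_ops ?S"
    using convolution_ops_bounded[OF T] commutant_bounded[OF V] .
  show "compose (ell2 ?S) T V \<in> bounded_ops ?S" "compose (ell2 ?S) V T \<in> bounded_ops ?S"
    using Tb Vb by simp_all
  fix a b assume a: "a \<in> ?S" and b: "b \<in> ?S"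
  let ?\<xi> = "T (unit_vec \<one>)"
  \<comment> \<open>Both sums are reindexed by the group element \<open>h\<close> at which the coefficient of \<^term>\<open>T\<close> is taken:
    \<open>y = h\<^sup>-\<^sup>1 b\<close> here, and \<open>y = h a\<close> for the other product.\<close>
  have "((\<lambda>y. V (unit_vec a) y * T (unit_vec y) b) has_sum T (V (unit_vec a)) b) ?S"
    using Tb Vb a by (intro bounded_ops_matrix_expand) auto
  moreover have "bij_betw (\<lambda>h. inv h \<otimes> b) ?S ?S"
    using bij_betw_trans[OF bij_inv bij_right_mult[OF b]] by (simp add: o_def)
  ultimately have "((\<lambda>h. V (unit_vec a) (inv h \<otimes> b) * T (unit_vec (inv h \<otimes> b)) b)
      has_sum T (V (unit_vec a)) b) ?S"
    by (subst has_sum_reindex_bij_betw[where f = "\<lambda>y. V (unit_vec a) y * T (unit_vec y) b"])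
  moreover have "T (unit_vec (inv h \<otimes> b)) b = ?\<xi> h" if h: "h \<in> ?S" for h
  proof -
    have "b \<otimes> inv (inv h \<otimes> b) = h" using h b by (simp add: inv_mult_group m_assoc[symmetric])
    then show ?thesis using convolution_ops_matrix[OF T, of "inv h \<otimes> b" b] h b by simp
  qed
  ultimately have 1: "((\<lambda>h. ?\<xi> h * V (unit_vec a) (inv h \<otimes> b)) has_sum T (V (unit_vec a)) b) ?S"
    by (simp add: mult.commute cong: has_sum_cong)
  have "((\<lambda>y. T (unit_vec a) y * V (unit_vec y) b) has_sum V (T (unit_vec a)) b) ?S"
    using Tb Vb a by (intro bounded_ops_matrix_expand) auto
  then have "((\<lambda>h. T (unit_vec a) (h \<otimes> a) * V (unit_vec (h \<otimes> a)) b) has_sum V (T (unit_vec a)) b) ?S"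
    by (subst has_sum_reindex_bij_betw[OF bij_right_mult[OF a], where f = "\<lambda>y. T (unit_vec a) y * V (unit_vec y) b"])
  moreover have "T (unit_vec a) (h \<otimes> a) * V (unit_vec (h \<otimes> a)) b = ?\<xi> h * V (unit_vec a) (inv h \<otimes> b)"
    if h: "h \<in> ?S" for h
  proof -
    have t: "T (unit_vec a) (h \<otimes> a) = ?\<xi> h"
      using convolution_ops_matrix[OF T a, of "h \<otimes> a"] h a by (simp add: m_assoc)
    show ?thesis
    proof (cases "h \<in> H")
      case True
      have "V (unit_vec (h \<otimes> a)) = left_regular G h (V (unit_vec a))"
        using commutantD[OF V imageI[OF True], of "unit_vec a"] a h by (simp add: left_regular_unit_vec)
      then show ?thesis using t Vb a b by (simp add: left_regular_def)
    next
      case False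
      then have "?\<xi> h = 0" using convolution_ops_support[OF T h] by simp
      then show ?thesis using t by simp
    qed
  qed
  ultimately have 2: "((\<lambda>h. ?\<xi> h * V (unit_vec a) (inv h \<otimes> b)) has_sum V (T (unit_vec a)) b) ?S"
    by (simp cong: has_sum_cong)
  show "compose (ell2 ?S) T V (unit_vec a) b = compose (ell2 ?S) V T (unit_vec a) b"
    using has_sum_unique[OF 1 2] a by simp
qed

text \<open>An operator in the bicommutant commutes with the right translations, which gives its matrix the form
  \<open>\<xi>(b y\<^sup>-\<^sup>1)\<close>, and with the projection onto the coordinates in \<^term>\<open>H\<close>, which places the support of
  \<open>\<xi>\<close> inside \<^term>\<open>H\<close>. The other inclusion is the commutation just proved.\<close>
lemma double_commutant_left_regular:
  assumes H: "subgroup H G"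
  shows "commutant (carrier G) (commutant (carrier G) (left_regular G ` H)) = convolution_ops H"
    (is "?C = _")
proof
  let ?S = "carrier G"
  have sub: "H \<subseteq> ?S" using H by (rule subgroup.subset)
  show "?C \<subseteq> convolution_ops H"
  proof
    fix T assume T: "T \<in> ?C"
    have Tb: "T \<in> bounded_ops ?S" using T by (rule commutant_bounded)
    have "T (unit_vec y) b = T (unit_vec \<one>) (b \<otimes> inv y)" if y: "y \<in> ?S" and b: "b \<in> ?S" for y b
    proof -
      \<comment> \<open>Right translation carries \<open>\<delta>\<^sub>1\<close> to \<open>\<delta>\<^sub>y\<close>.\<close>
      let ?R = "perm_op ?S (\<lambda>x. x \<otimes> inv y)"
      have "x \<otimes> inv y = \<one> \<longleftrightarrow> x = y" if "x \<in> ?S" for x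
        using that y by (metis inv_solve_right l_one one_closed r_inv)
      then have "?R (unit_vec \<one>) = unit_vec y"
        using y unit_vec_ell2[OF one_closed] unfolding perm_op_def by (auto simp: unit_vec_def)
      then have "T (unit_vec y) = ?R (T (unit_vec \<one>))"
        using commutantD[OF T right_translation_in_commutant_left_regular[OF sub, of "inv y"], of "unit_vec \<one>"] y
        by simp
      then show ?thesis using Tb b by (simp add: perm_op_def)
    qed
    moreover have "T (unit_vec \<one>) x = 0" if "x \<in> ?S - H" for x
    proof -
      have "restr H (unit_vec \<one>) = unit_vec \<one>"
        using subgroup.one_closed[OF H] by (auto simp: restr_def unit_vec_def)
      then have "T (unit_vec \<one>) = restr H (T (unit_vec \<one>))"
        using commutantD[OF T restr_in_commutant_left_regular[OF H], of "unit_vec \<one>"] Tb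
        by (simp add: restr_op_def)
      then show ?thesis using that by (metis DiffD2 restr_out)
    qed
    ultimately show "T \<in> convolution_ops H" using Tb by (blast intro: convolution_opsI)
  qed
  show "convolution_ops H \<subseteq> ?C"
    using convolution_ops_commute_commutant[OF H] convolution_ops_bounded
    unfolding commutant_def[of _ "commutant _ _"] by blast
qed

lemma convolution_ops_adj:
  assumes H: "subgroup H G" and T: "T \<in> convolution_ops H"
  shows "op_adj (carrier G) T \<in> convolution_ops H"
proof -
  have Tb: "T \<in> bounded_ops (carrier G)" using T by (rule convolution_ops_bounded)
  have m: "op_adj (carrier G) T (unit_vec y) b = cnj (T (unit_vec \<one>) (y \<otimes> inv b))"
    if "y \<in> carrier G" "b \<in> carrier G" for y b
    using op_adj_matrix[OF Tb that] convolution_ops_matrix[OF T that(2,1)] by simp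
  have "inv x \<notin> H" if "x \<in> carrier G - H" for x
    using that subgroup.m_inv_closed[OF H, of "inv x"] by auto
  then show ?thesis
    by (intro convolution_opsI) (use Tb in \<open>auto simp: m inv_mult_group convolution_ops_support[OF T]\<close>)
qed

lemma VN_eq_convolution_ops:
  assumes H: "subgroup H G"
  shows "VN G H = convolution_ops H" and "von_neumann_algebra (carrier G) (VN G H)"
  unfolding VN_def
  using vn_generated_eq_double_commutant[OF left_regular_subset_bounded[OF subgroup.subset[OF H]]]
    convolution_ops_adj[OF H] double_commutant_left_regular[OF H] by auto

lemma convolution_ops_closed:
  assumes H: "subgroup H G"
  shows convolution_ops_one: "op_one (carrier G) \<in> convolution_ops H"
    and convolution_ops_compose: "T \<in> convolution_ops H \<Longrightarrow> U \<in> convolution_ops H \<Longrightarrow>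
      compose (ell2 (carrier G)) T U \<in> convolution_ops H"
    and convolution_ops_add: "T \<in> convolution_ops H \<Longrightarrow> U \<in> convolution_ops H \<Longrightarrow>
      op_add (carrier G) T U \<in> convolution_ops H"
    and convolution_ops_scale: "T \<in> convolution_ops H \<Longrightarrow> op_scale (carrier G) c T \<in> convolution_ops H"
    and convolution_ops_diff: "T \<in> convolution_ops H \<Longrightarrow> U \<in> convolution_ops H \<Longrightarrow>
      op_diff (carrier G) T U \<in> convolution_ops H"
proof -
  have "commutant (carrier G) (left_regular G ` H) \<subseteq> bounded_ops (carrier G)"
    using commutant_bounded by blast
  note c = commutant_closed[OF this, unfolded double_commutant_left_regular[OF H]]
  show "op_one (carrier G) \<in> convolution_ops H" by (rule c(1))
  show "T \<in> convolution_ops H \<Longrightarrow> U \<in> convolution_ops H \<Longrightarrow> compose (ell2 (carrier G)) T U \<in> convolution_ops H"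
    by (rule c(2))
  show "T \<in> convolution_ops H \<Longrightarrow> U \<in> convolution_ops H \<Longrightarrow> op_add (carrier G) T U \<in> convolution_ops H"
    by (rule c(3))
  show "T \<in> convolution_ops H \<Longrightarrow> op_scale (carrier G) c T \<in> convolution_ops H"
    by (rule c(4))
  show "T \<in> convolution_ops H \<Longrightarrow> U \<in> convolution_ops H \<Longrightarrow> op_diff (carrier G) T U \<in> convolution_ops H"
    by (rule c(5))
qed

lemma left_regular_in_convolution_ops:
  "subgroup H G \<Longrightarrow> h \<in> H \<Longrightarrow> left_regular G h \<in> convolution_ops H"
  using subset_double_commutant[OF left_regular_subset_bounded[OF subgroup.subset]]
    double_commutant_left_regular by blast

lemma convolution_ops_mono: "H \<subseteq> K \<Longrightarrow> convolution_ops H \<subseteq> convolution_ops K"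
  unfolding convolution_ops_def by blast

lemma convolution_ops_restr:
  assumes "subgroup H G" "T \<in> convolution_ops H" "f \<in> ell2 (carrier G)"
  shows "T (restr H f) = restr H (T f)"
proof -
  have "T \<in> commutant (carrier G) (commutant (carrier G) (left_regular G ` H))"
    using assms double_commutant_left_regular by simp
  from commutantD[OF this restr_in_commutant_left_regular[OF assms(1)] assms(3)]
  show ?thesis using assms(3) convolution_ops_bounded[OF assms(2)] by (simp add: restr_op_def)
qed

lemma convolution_ops_eqI:
  assumes "T \<in> convolution_ops H" "U \<in> convolution_ops K"
    and "T (unit_vec \<one>) = U (unit_vec \<one>)"
  shows "T = U"
proof (rule op_eq_if_matrix_eq)
  fix y b assume "y \<in> carrier G" "b \<in> carrier G"
  then show "T (unit_vec y) b = U (unit_vec y) b"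
    using convolution_ops_matrix[OF assms(1), of y b] convolution_ops_matrix[OF assms(2), of y b]
      assms(3) by simp
qed (use assms convolution_ops_bounded in auto)

section \<open>The trace\<close>

lemma delta_one_unit_vec: "delta_one G = unit_vec \<one>"
  by (simp add: delta_one_def unit_vec_def)

lemma group_trace_eq:
  "group_trace G T = T (unit_vec \<one>) \<one>"
  by (simp add: group_trace_def delta_one_unit_vec ell2_inner_unit_vec_right)

lemma group_trace_adj_self:
  assumes T: "T \<in> bounded_ops (carrier G)"
  shows "group_trace G (compose (ell2 (carrier G)) (op_adj (carrier G) T) T) =
    of_real ((ell2_norm (carrier G) (T (unit_vec \<one>)))\<^sup>2)"
proof -
  have d: "unit_vec \<one> \<in> ell2 (carrier G)" "T (unit_vec \<one>) \<in> ell2 (carrier G)" using T by auto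
  show ?thesis
    using op_adj_inner'[OF T d(2,1)] d
    by (simp add: group_trace_def delta_one_unit_vec ell2_inner_self)
qed

lemma trace_norm2_group_trace:
  assumes "T \<in> bounded_ops (carrier G)"
  shows "trace_norm2 (carrier G) (group_trace G) T = ell2_norm (carrier G) (T (unit_vec \<one>))"
  unfolding trace_norm2_def group_trace_adj_self[OF assms] by simp

text \<open>With \<open>\<xi> = T \<delta>\<^sub>1\<close> and \<open>\<eta> = U \<delta>\<^sub>1\<close> the two traces are \<open>\<Sum>\<^sub>y \<eta>(y) \<xi>(y\<^sup>-\<^sup>1)\<close> and
  \<open>\<Sum>\<^sub>y \<xi>(y) \<eta>(y\<^sup>-\<^sup>1)\<close>, exchanged by \<open>y \<mapsto> y\<^sup>-\<^sup>1\<close>.\<close>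
lemma group_trace_commute:
  assumes T: "T \<in> convolution_ops (carrier G)" and U: "U \<in> convolution_ops (carrier G)"
  shows "group_trace G (compose (ell2 (carrier G)) T U) = group_trace G (compose (ell2 (carrier G)) U T)"
proof -
  let ?S = "carrier G" and ?d = "unit_vec \<one> :: 'a vec"
  have exp: "((\<lambda>y. U ?d y * T ?d (inv y)) has_sum T (U ?d) \<one>) ?S"
    if "T \<in> convolution_ops ?S" "U \<in> convolution_ops ?S" for T U
  proof -
    have "((\<lambda>y. U ?d y * T (unit_vec y) \<one>) has_sum T (U ?d) \<one>) ?S"
      using that by (intro bounded_ops_matrix_expand) (auto simp: convolution_ops_bounded)
    moreover have "T (unit_vec y) \<one> = T ?d (inv y)" if "y \<in> ?S" for y
      using convolution_ops_matrix[OF \<open>T \<in> convolution_ops ?S\<close> that one_closed] that by simp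
    ultimately show ?thesis by (simp cong: has_sum_cong)
  qed
  have "((\<lambda>y. U ?d (inv y) * T ?d (inv (inv y))) has_sum T (U ?d) \<one>) ?S"
    using exp[OF T U] by (subst has_sum_reindex_bij_betw[OF bij_inv, where f = "\<lambda>y. U ?d y * T ?d (inv y)"])
  then have "((\<lambda>y. T ?d y * U ?d (inv y)) has_sum T (U ?d) \<one>) ?S"
    by (simp add: mult.commute cong: has_sum_cong)
  then have "T (U ?d) \<one> = U (T ?d) \<one>" using exp[OF U T] by (rule has_sum_unique)
  then show ?thesis by (simp add: group_trace_eq)
qed

lemma ell2_norm_adj_unit_vec:
  assumes T: "T \<in> convolution_ops (carrier G)"
  shows "ell2_norm (carrier G) (op_adj (carrier G) T (unit_vec \<one>)) = ell2_norm (carrier G) (T (unit_vec \<one>))"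
proof -
  let ?S = "carrier G"
  have Tb: "T \<in> bounded_ops ?S" using T by (rule convolution_ops_bounded)
  have "complex_of_real ((ell2_norm ?S (op_adj ?S T (unit_vec \<one>)))\<^sup>2) = of_real ((ell2_norm ?S (T (unit_vec \<one>)))\<^sup>2)"
    using group_trace_adj_self[OF Tb] group_trace_adj_self[OF op_adj_bounded[OF Tb]]
      group_trace_commute[OF convolution_ops_adj[OF subgroup_self T] T]
    by (simp only: op_adj_op_adj[OF Tb])
  then show ?thesis unfolding of_real_eq_iff by (simp add: power2_eq_iff_nonneg)
qed

section \<open>Conditional expectations\<close>

text \<open>Two candidates satisfy \<open>tr (E x a) = tr (x a) = tr (E' x a)\<close> for all \<open>a\<close> in \<^term>\<open>N\<close>. Taking for
  \<open>a\<close> the adjoint of \<open>d = E x - E' x\<close> gives \<open>tr (d d\<^sup>*) = 0\<close>, hence \<open>d \<delta>\<^sub>1 = 0\<close>, and \<open>\<delta>\<^sub>1\<close> separates.\<close>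
lemma trace_preserving_cond_exp_unique:
  assumes N: "N \<subseteq> convolution_ops (carrier G)" "op_one (carrier G) \<in> N"
      "\<And>a b. a \<in> N \<Longrightarrow> b \<in> N \<Longrightarrow> op_diff (carrier G) a b \<in> N"
      "\<And>a. a \<in> N \<Longrightarrow> op_adj (carrier G) a \<in> N"
    and E: "trace_preserving_cond_exp (carrier G) (convolution_ops (carrier G)) (group_trace G) N E"
    and E': "trace_preserving_cond_exp (carrier G) (convolution_ops (carrier G)) (group_trace G) N E'"
  shows "E = E'"
proof -
  let ?S = "carrier G" and ?M = "convolution_ops (carrier G)" and ?d = "unit_vec \<one> :: 'a vec"
  have tr: "group_trace G (compose (ell2 ?S) (E x) a) = group_trace G (compose (ell2 ?S) x a)"
    if E: "trace_preserving_cond_exp ?S ?M (group_trace G) N E" and x: "x \<in> ?M" and a: "a \<in> N" for E x a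
  proof -
    have aM: "a \<in> ?M" and ExM: "E x \<in> ?M"
      using N(1) a x E by (auto simp: trace_preserving_cond_exp_def)
    have one: "compose (ell2 ?S) (op_one ?S) y = y" if "y \<in> ?M" for y
      using convolution_ops_bounded[OF that]
      by (intro op_eqI[where S = ?S]) (auto simp: bounded_ops_extensional)
    have xa: "compose (ell2 ?S) x a \<in> ?M" "compose (ell2 ?S) (E x) a \<in> ?M"
      using x aM ExM convolution_ops_compose[OF subgroup_self] by auto
    have "E (compose (ell2 ?S) (op_one ?S) (compose (ell2 ?S) x a)) =
      compose (ell2 ?S) (op_one ?S) (compose (ell2 ?S) (E x) a)"
      using E N(2) a x unfolding trace_preserving_cond_exp_def by blast
    then have "E (compose (ell2 ?S) x a) = compose (ell2 ?S) (E x) a"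
      using one xa by simp
    then show ?thesis using E xa(1) unfolding trace_preserving_cond_exp_def by metis
  qed
  have "E x = E' x" if x: "x \<in> ?M" for x
  proof -
    have N': "E x \<in> N" "E' x \<in> N"
      using x E E' by (auto simp: trace_preserving_cond_exp_def)
    let ?D = "op_diff ?S (E x) (E' x)" and ?a = "op_adj ?S (op_diff ?S (E x) (E' x))"
    have D: "?D \<in> N" "?a \<in> N" using N N' by auto
    have DM: "?D \<in> ?M" "?D \<in> bounded_ops ?S" using D N(1) convolution_ops_bounded by auto
    have ad: "?a ?d \<in> ell2 ?S" using DM(2) by simp
    have "group_trace G (compose (ell2 ?S) ?D ?a) =
      group_trace G (compose (ell2 ?S) (E x) ?a) - group_trace G (compose (ell2 ?S) (E' x) ?a)"
      using ad by (simp add: group_trace_eq)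
    also have "\<dots> = 0" using tr[OF E x D(2)] tr[OF E' x D(2)] by simp
    finally have "group_trace G (compose (ell2 ?S) (op_adj ?S ?a) ?a) = 0"
      using op_adj_op_adj[OF DM(2)] by simp
    then have "complex_of_real ((ell2_norm ?S (?a ?d))\<^sup>2) = 0"
      using group_trace_adj_self[OF op_adj_bounded[OF DM(2)]] by simp
    then have "ell2_norm ?S (?D ?d) = 0"
      using ell2_norm_adj_unit_vec[OF DM(1)] by simp
    then have "?D ?d = (\<lambda>x. 0)"
      by (rule ell2_norm_eq_0[OF bounded_ops_values[OF DM(2) unit_vec_ell2[OF one_closed]]])
    then have "E x ?d = E' x ?d" by (simp add: fun_eq_iff)
    then show ?thesis using N' N(1) by (intro convolution_ops_eqI[of _ ?S _ ?S]) auto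
  qed
  moreover have "E \<in> extensional ?M" "E' \<in> extensional ?M"
    using E E' unfolding trace_preserving_cond_exp_def PiE_def by blast+
  ultimately show ?thesis by (intro extensionalityI[of E ?M E'])
qed

lemma cond_exp_eqI:
  assumes N: "N \<subseteq> convolution_ops (carrier G)" "op_one (carrier G) \<in> N"
      "\<And>a b. a \<in> N \<Longrightarrow> b \<in> N \<Longrightarrow> op_diff (carrier G) a b \<in> N"
      "\<And>a. a \<in> N \<Longrightarrow> op_adj (carrier G) a \<in> N"
    and E: "trace_preserving_cond_exp (carrier G) (convolution_ops (carrier G)) (group_trace G) N E"
  shows "cond_exp (carrier G) (convolution_ops (carrier G)) (group_trace G) N = E"
  unfolding cond_exp_def
proof (rule the_equality)
  show "E' = E"
    if "trace_preserving_cond_exp (carrier G) (convolution_ops (carrier G)) (group_trace G) N E'" for E'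
    by (rule trace_preserving_cond_exp_unique[OF N that E])
qed (rule E)

text \<open>The blocks are the right cosets of \<^term>\<open>H\<close>. Compressing to them keeps the entry \<open>\<xi>(b y\<^sup>-\<^sup>1)\<close>
  exactly when \<open>b y\<^sup>-\<^sup>1 \<in> H\<close>, so this is restriction of the coefficient vector to \<^term>\<open>H\<close>, in a form
  for which boundedness and positivity are clear.\<close>
definition coset_compression :: "'a set \<Rightarrow> 'a op \<Rightarrow> 'a op" where
  "coset_compression H T = block_diag (carrier G) (\<lambda>x. H #> x) T"

lemma rcos_eq_iff:
  assumes H: "subgroup H G" and "y \<in> carrier G" "b \<in> carrier G"
  shows "H #> y = H #> b \<longleftrightarrow> b \<otimes> inv y \<in> H"
  using assms subgroup.rcos_module[OF H is_group assms(2,3)] repr_independence[OF _ assms(2) H] rcos_self[OF assms(3) H]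
  by metis

lemma coset_compression_matrix:
  assumes H: "subgroup H G" and T: "T \<in> bounded_ops (carrier G)"
    and y: "y \<in> carrier G" and b: "b \<in> carrier G"
  shows "coset_compression H T (unit_vec y) b = (if b \<otimes> inv y \<in> H then T (unit_vec y) b else 0)"
proof -
  have "restr {x. H #> x = H #> b} (unit_vec y) = (if b \<otimes> inv y \<in> H then unit_vec y else (\<lambda>x. 0))"
    unfolding rcos_eq_iff[OF H y b, symmetric] restr_def unit_vec_def by (intro ext) auto
  moreover have "T (\<lambda>x. 0) = (\<lambda>x. 0)"
    using bounded_ops_linear(2)[OF T ell2_zero, of 0] by simp
  ultimately show ?thesis using y by (simp add: coset_compression_def block_diag_def)
qed

lemma coset_compression_mem:
  assumes H: "subgroup H G" and T: "T \<in> convolution_ops (carrier G)"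
  shows "coset_compression H T \<in> convolution_ops H"
proof (rule convolution_opsI)
  have Tb: "T \<in> bounded_ops (carrier G)" using T by (rule convolution_ops_bounded)
  note m = coset_compression_matrix[OF H Tb]
  show "coset_compression H T \<in> bounded_ops (carrier G)"
    unfolding coset_compression_def by (rule block_diag_bounded[OF Tb])
  show "coset_compression H T (unit_vec y) b = coset_compression H T (unit_vec \<one>) (b \<otimes> inv y)"
    if "y \<in> carrier G" "b \<in> carrier G" for y b
    using m[OF that] m[OF one_closed, of "b \<otimes> inv y"] convolution_ops_matrix[OF T that] that by simp
  show "coset_compression H T (unit_vec \<one>) x = 0" if "x \<in> carrier G" "x \<notin> H" for x
    using m[OF one_closed that(1)] that by simp
qed

text \<open>On vectors supported in the coset \<^term>\<open>H\<close> itself only one block is active.\<close>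
lemma coset_compression_supported:
  assumes H: "subgroup H G" and T: "T \<in> bounded_ops (carrier G)"
    and f: "f \<in> ell2 (carrier G)"
  shows "coset_compression H T (restr H f) = restr H (T (restr H f))"
proof
  fix b
  have r: "restr H f \<in> ell2 (carrier G)" using f by (rule restr_ell2)
  show "coset_compression H T (restr H f) b = restr H (T (restr H f)) b"
  proof (cases "b \<in> carrier G")
    case True
    have "H #> x = H #> b \<longleftrightarrow> b \<in> H" if "x \<in> H" for x
    proof -
      have xG: "x \<in> carrier G" using subgroup.mem_carrier[OF H that] .
      have "H #> x = H" using subgroup.rcos_const[OF H is_group that] .
      moreover have "H #> b = H \<longleftrightarrow> b \<in> H"
        using subgroup.rcos_const[OF H is_group, of b] rcos_self[OF True H] by auto
      ultimately show ?thesis by auto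
    qed
    then have "restr {x. H #> x = H #> b} (restr H f) x = (if b \<in> H then restr H f else (\<lambda>x. 0)) x" for x
      by (cases "x \<in> H") (simp_all add: restr_def)
    then have "restr {x. H #> x = H #> b} (restr H f) = (if b \<in> H then restr H f else (\<lambda>x. 0))"
      by (rule ext)
    moreover have "T (\<lambda>x. 0) = (\<lambda>x. 0)"
      using bounded_ops_linear(2)[OF T ell2_zero, of 0] by simp
    ultimately show ?thesis using r by (simp add: coset_compression_def block_diag_def)
  next
    case False
    have "coset_compression H T (restr H f) \<in> ell2 (carrier G)"
      unfolding coset_compression_def by (rule bounded_ops_values[OF block_diag_bounded[OF T] r])
    moreover have "restr H (T (restr H f)) \<in> ell2 (carrier G)"
      by (rule restr_ell2(1)[OF bounded_ops_values[OF T r]])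
    ultimately show ?thesis using ell2_outside[OF _ False] by metis
  qed
qed

lemma coset_compression_unit_vec:
  assumes H: "subgroup H G" and T: "T \<in> bounded_ops (carrier G)"
  shows "coset_compression H T (unit_vec \<one>) = restr H (T (unit_vec \<one>))"
proof -
  have "restr H (unit_vec \<one>) = unit_vec \<one>"
    using subgroup.one_closed[OF H] by (auto simp: restr_def unit_vec_def)
  then show ?thesis using coset_compression_supported[OF H T, of "unit_vec \<one>"] by simp
qed

text \<open>All identities may be checked on \<open>\<delta>\<^sub>1\<close>, where the compression becomes restriction to \<^term>\<open>H\<close>;
  the bimodule law then holds because operators supported on \<^term>\<open>H\<close> commute with that restriction.\<close>
lemma coset_compression_cond_exp:
  assumes H: "subgroup H G"
  shows "trace_preserving_cond_exp (carrier G) (convolution_ops (carrier G)) (group_trace G)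
    (convolution_ops H) (restrict (coset_compression H) (convolution_ops (carrier G)))"
proof -
  let ?S = "carrier G" and ?M = "convolution_ops (carrier G)" and ?N = "convolution_ops H"
  let ?E = "coset_compression H" and ?d = "unit_vec \<one> :: 'a vec"
  have d: "?d \<in> ell2 ?S" by simp
  have NM: "?N \<subseteq> ?M" by (rule convolution_ops_mono[OF subgroup.subset[OF H]])
  note cl = convolution_ops_closed[OF subgroup_self]
  have EN: "?E x \<in> ?N" if "x \<in> ?M" for x by (rule coset_compression_mem[OF H that])
  have Ed: "?E x ?d = restr H (x ?d)" if "x \<in> ?M" for x
    by (rule coset_compression_unit_vec[OF H convolution_ops_bounded[OF that]])
  have eq: "x = y" if "x \<in> ?M" "y \<in> ?M" "x ?d = y ?d" for x y
    by (rule convolution_ops_eqI[OF that])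
  have Nd: "restr H (a ?d) = a ?d" if "a \<in> ?N" for a
    using coset_compression_unit_vec[OF H convolution_ops_bounded[OF that]]
  proof -
    have "a ?d x = 0" if "x \<notin> H" for x
    proof (cases "x \<in> ?S")
      case True then show ?thesis using convolution_ops_support[OF \<open>a \<in> ?N\<close>] that by blast
    next
      case False
      then show ?thesis
        using ell2_outside[OF bounded_ops_values[OF convolution_ops_bounded[OF \<open>a \<in> ?N\<close>] d]] by blast
    qed
    then show ?thesis by (auto simp: restr_def)
  qed
  have add: "?E (op_add ?S x y) = op_add ?S (?E x) (?E y)" if "x \<in> ?M" "y \<in> ?M" for x y
  proof (rule eq)
    show "?E (op_add ?S x y) ?d = op_add ?S (?E x) (?E y) ?d"
      using that cl(3)[OF that] by (simp add: Ed restr_add)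
  qed (use that EN NM cl(3) in blast)+
  have scale: "?E (op_scale ?S c x) = op_scale ?S c (?E x)" if "x \<in> ?M" for x c
  proof (rule eq)
    show "?E (op_scale ?S c x) ?d = op_scale ?S c (?E x) ?d"
      using that cl(4)[OF that] by (simp add: Ed restr_scale)
  qed (use that EN NM cl(4) in blast)+
  have ident: "?E a = a" if "a \<in> ?N" for a
    by (rule eq) (use that EN NM Ed Nd in auto)
  have bimod: "?E (compose (ell2 ?S) a (compose (ell2 ?S) x b)) = compose (ell2 ?S) a (compose (ell2 ?S) (?E x) b)"
    if a: "a \<in> ?N" and b: "b \<in> ?N" and x: "x \<in> ?M" for a b x
  proof (rule eq)
    have aM: "a \<in> ?M" and bM: "b \<in> ?M" using a b NM by auto
    show "?E (compose (ell2 ?S) a (compose (ell2 ?S) x b)) \<in> ?M"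
      by (rule subsetD[OF NM EN[OF cl(2)[OF aM cl(2)[OF x bM]]]])
    show "compose (ell2 ?S) a (compose (ell2 ?S) (?E x) b) \<in> ?M"
      by (rule cl(2)[OF aM cl(2)[OF subsetD[OF NM EN[OF x]] bM]])
    have bnd: "a \<in> bounded_ops ?S" "b \<in> bounded_ops ?S" "x \<in> bounded_ops ?S"
      using aM bM x convolution_ops_bounded by auto
    have "?E (compose (ell2 ?S) a (compose (ell2 ?S) x b)) ?d = restr H (a (x (b ?d)))"
      using Ed[OF cl(2)[OF aM cl(2)[OF x bM]]] bnd by simp
    also have "\<dots> = a (restr H (x (b ?d)))"
      using convolution_ops_restr[OF H a, of "x (b ?d)"] bnd by simp
    also have "restr H (x (b ?d)) = ?E x (b ?d)"
      using coset_compression_supported[OF H bnd(3), of "b ?d"] Nd[OF b] bnd by simp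
    finally show "?E (compose (ell2 ?S) a (compose (ell2 ?S) x b)) ?d
      = compose (ell2 ?S) a (compose (ell2 ?S) (?E x) b) ?d" by simp
  qed
  have trace: "group_trace G (?E x) = group_trace G x" if "x \<in> ?M" for x
    using Ed[OF that] subgroup.one_closed[OF H] by (simp add: group_trace_eq)
  have pos: "op_positive ?S (?E x)" if "op_positive ?S x" for x
    unfolding coset_compression_def using that by (rule block_diag_positive)
  show ?thesis unfolding trace_preserving_cond_exp_def
    using EN NM add scale ident bimod trace pos cl by (auto simp: subset_iff)
qed

lemma cond_exp_eq_coset_compression:
  assumes H: "subgroup H G" and x: "x \<in> convolution_ops (carrier G)"
  shows "cond_exp (carrier G) (convolution_ops (carrier G)) (group_trace G) (convolution_ops H) x
    = coset_compression H x"
proof -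
  have "cond_exp (carrier G) (convolution_ops (carrier G)) (group_trace G) (convolution_ops H)
    = restrict (coset_compression H) (convolution_ops (carrier G))"
    by (intro cond_exp_eqI convolution_ops_mono[OF subgroup.subset[OF H]] convolution_ops_one[OF H]
        convolution_ops_diff[OF H] convolution_ops_adj[OF H] coset_compression_cond_exp[OF H])
  then show ?thesis using x by simp
qed

lemma op_conj_convolution_ops:
  assumes u: "u \<in> convolution_ops (carrier G)" and a: "a \<in> convolution_ops (carrier G)"
  shows "op_conj (carrier G) u a \<in> convolution_ops (carrier G)"
  unfolding op_conj_def
  by (intro convolution_ops_compose[OF subgroup_self] u a convolution_ops_adj[OF subgroup_self])

text \<open>Conjugation by \<^term>\<open>u\<close> is a trace preserving, positive automorphism of the whole algebra, so it
  transports the expectation onto the subalgebra to one onto the conjugated subalgebra.\<close>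
lemma conjugate_cond_exp:
  assumes H: "subgroup H G" and u: "u \<in> unitaries (carrier G) (convolution_ops (carrier G))"
  shows "trace_preserving_cond_exp (carrier G) (convolution_ops (carrier G)) (group_trace G)
    (op_conj (carrier G) u ` convolution_ops H)
    (\<lambda>x\<in>convolution_ops (carrier G).
       op_conj (carrier G) u (coset_compression H (op_conj (carrier G) (op_adj (carrier G) u) x)))"
proof -
  let ?S = "carrier G" and ?M = "convolution_ops (carrier G)" and ?N = "convolution_ops H"
  let ?E = "coset_compression H" and ?d = "unit_vec \<one> :: 'a vec"
  let ?c = "op_conj ?S u" and ?c' = "op_conj ?S (op_adj ?S u)"
  have Mb: "?M \<subseteq> bounded_ops ?S" using convolution_ops_bounded by blast
  note up = unitaries_props[OF u Mb]
  have u'M: "op_adj ?S u \<in> ?M" by (rule convolution_ops_adj[OF subgroup_self up(1)])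
  have u'b: "op_adj ?S u \<in> bounded_ops ?S" using up(2) by simp
  have NM: "?N \<subseteq> ?M" by (rule convolution_ops_mono[OF subgroup.subset[OF H]])
  note cl = convolution_ops_closed[OF subgroup_self]
  have cM: "?c x \<in> ?M" "?c' x \<in> ?M" if "x \<in> ?M" for x
    using op_conj_convolution_ops[OF up(1) that] op_conj_convolution_ops[OF u'M that] .
  have ca: "?c x f = u (x (op_adj ?S u f))" "?c' x f = op_adj ?S u (x (u f))" if "f \<in> ell2 ?S" for x f
    using that up(2) by (simp_all add: op_conj_apply op_adj_op_adj)
  have b: "x \<in> bounded_ops ?S" if "x \<in> ?M" for x using that Mb by blast
  have cc': "?c (?c' x) = x" if "x \<in> ?M" for x
    using b[OF that] up by (intro op_eqI[where S = ?S]) (auto simp: ca bounded_ops_extensional)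
  have c'c: "?c' (?c x) = x" if "x \<in> ?M" for x
    using b[OF that] up by (intro op_eqI[where S = ?S]) (auto simp: ca bounded_ops_extensional)
  have cadd: "?c (op_add ?S x y) = op_add ?S (?c x) (?c y)"
    "?c' (op_add ?S x y) = op_add ?S (?c' x) (?c' y)" if "x \<in> ?M" "y \<in> ?M" for x y
    using b[OF that(1)] b[OF that(2)] up(2) u'b
    by (auto intro!: op_eqI[where S = ?S]
      simp: ca bounded_ops_linear[OF up(2)] bounded_ops_linear[OF u'b])
  have cscale: "?c (op_scale ?S k x) = op_scale ?S k (?c x)"
    "?c' (op_scale ?S k x) = op_scale ?S k (?c' x)" if "x \<in> ?M" for x k
    using b[OF that(1)] up(2) u'b
    by (auto intro!: op_eqI[where S = ?S]
      simp: ca bounded_ops_linear[OF up(2)] bounded_ops_linear[OF u'b])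
  have cmult: "?c (compose (ell2 ?S) x y) = compose (ell2 ?S) (?c x) (?c y)"
    "?c' (compose (ell2 ?S) x y) = compose (ell2 ?S) (?c' x) (?c' y)" if "x \<in> ?M" "y \<in> ?M" for x y
    using b[OF that(1)] b[OF that(2)] up u'b
    by (auto intro!: op_eqI[where S = ?S] simp: ca)
  have cpos: "op_positive ?S (?c x)" "op_positive ?S (?c' x)" if "op_positive ?S x" for x
  proof -
    have xb: "x \<in> bounded_ops ?S" and p: "\<And>f. f \<in> ell2 ?S \<Longrightarrow> ell2_inner ?S (x f) f \<in> \<real>\<^sub>\<ge>\<^sub>0"
      using that by (auto simp: op_positive_def)
    show "op_positive ?S (?c x)" unfolding op_positive_def
      using up(2) u'b xb p by (auto simp: op_conj_bounded ca op_adj_inner[OF up(2)])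
    show "op_positive ?S (?c' x)" unfolding op_positive_def
      using up(2) u'b xb p by (auto simp: op_conj_bounded ca op_adj_inner'[OF up(2)])
  qed
  have ctr: "group_trace G (?c x) = group_trace G x" if "x \<in> ?M" for x
  proof -
    have "group_trace G (?c x) = group_trace G (compose (ell2 ?S) (compose (ell2 ?S) x (op_adj ?S u)) u)"
      unfolding op_conj_def by (rule group_trace_commute[OF up(1) cl(2)[OF that u'M]])
    also have "compose (ell2 ?S) (compose (ell2 ?S) x (op_adj ?S u)) u = x"
      using b[OF that] up by (intro op_eqI[where S = ?S]) (auto simp: bounded_ops_extensional)
    finally show ?thesis .
  qed
  have ctr': "group_trace G (?c' x) = group_trace G x" if "x \<in> ?M" for x
    using ctr[OF cM(2)[OF that]] cc'[OF that] by simp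
  have E: "trace_preserving_cond_exp ?S ?M (group_trace G) ?N (restrict ?E ?M)"
    by (rule coset_compression_cond_exp[OF H])
  note D = E[unfolded trace_preserving_cond_exp_def]
  have EN: "?E x \<in> ?N" if "x \<in> ?M" for x by (rule coset_compression_mem[OF H that])
  have EM: "?E x \<in> ?M" if "x \<in> ?M" for x using EN[OF that] NM by blast
  have Eadd: "?E (op_add ?S x y) = op_add ?S (?E x) (?E y)" if "x \<in> ?M" "y \<in> ?M" for x y
    using D that cl(3)[OF that] by (metis restrict_apply')
  have Escale: "?E (op_scale ?S k x) = op_scale ?S k (?E x)" if "x \<in> ?M" for x k
    using D that cl(4)[OF that] by (metis restrict_apply')
  have Eid: "?E a = a" if "a \<in> ?N" for a
    using D that NM by (metis restrict_apply' subsetD)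
  have Epos: "op_positive ?S (?E x)" if "op_positive ?S x" for x
    unfolding coset_compression_def using that by (rule block_diag_positive)
  have Etr: "group_trace G (?E x) = group_trace G x" if "x \<in> ?M" for x
    using D that by (metis restrict_apply')
  have Ebi: "?E (compose (ell2 ?S) a (compose (ell2 ?S) x b)) = compose (ell2 ?S) a (compose (ell2 ?S) (?E x) b)"
    if "a \<in> ?N" "b \<in> ?N" "x \<in> ?M" for a b x
  proof -
    have "compose (ell2 ?S) a (compose (ell2 ?S) x b) \<in> ?M"
      by (rule cl(2)[OF subsetD[OF NM that(1)] cl(2)[OF that(3) subsetD[OF NM that(2)]]])
    moreover have "restrict ?E ?M (compose (ell2 ?S) a (compose (ell2 ?S) x b)) =
      compose (ell2 ?S) a (compose (ell2 ?S) (restrict ?E ?M x) b)"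
      using D that by blast
    ultimately show ?thesis using that(3) by simp
  qed
  have bimod: "?c (?E (?c' (compose (ell2 ?S) (?c a) (compose (ell2 ?S) x (?c b))))) =
      compose (ell2 ?S) (?c a) (compose (ell2 ?S) (?c (?E (?c' x))) (?c b))"
    if a: "a \<in> ?N" and b: "b \<in> ?N" and x: "x \<in> ?M" for a b x
  proof -
    have aM: "a \<in> ?M" and bM: "b \<in> ?M" using a b NM by auto
    have "?c' (compose (ell2 ?S) (?c a) (compose (ell2 ?S) x (?c b))) =
      compose (ell2 ?S) a (compose (ell2 ?S) (?c' x) b)"
      using cmult(2) cM aM bM x c'c cl(2) by simp
    then show ?thesis
      using Ebi[OF a b cM(2)[OF x]] cmult(1) aM bM cl(2) EM[OF cM(2)[OF x]] by simp
  qed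
  show ?thesis unfolding trace_preserving_cond_exp_def
  proof (intro conjI ballI allI impI)
    show "(\<lambda>x\<in>?M. ?c (?E (?c' x))) \<in> ?M \<rightarrow>\<^sub>E ?c ` ?N"
      using EN cM(2) by auto
  next
    fix x y assume "x \<in> ?M" "y \<in> ?M"
    then show "(\<lambda>x\<in>?M. ?c (?E (?c' x))) (op_add ?S x y) =
      op_add ?S ((\<lambda>x\<in>?M. ?c (?E (?c' x))) x) ((\<lambda>x\<in>?M. ?c (?E (?c' x))) y)"
      by (simp add: cl(3) cadd cM Eadd EM)
  next
    fix k x assume "x \<in> ?M"
    then show "(\<lambda>x\<in>?M. ?c (?E (?c' x))) (op_scale ?S k x) =
      op_scale ?S k ((\<lambda>x\<in>?M. ?c (?E (?c' x))) x)"
      by (simp add: cl(4) cscale cM Escale EM)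
  next
    fix x assume "x \<in> ?M" "op_positive ?S x"
    then show "op_positive ?S ((\<lambda>x\<in>?M. ?c (?E (?c' x))) x)"
      by (simp add: cpos Epos)
  next
    fix a assume "a \<in> ?c ` ?N"
    then obtain a0 where a0: "a0 \<in> ?N" "a = ?c a0" by blast
    then have "a0 \<in> ?M" using NM by blast
    then show "(\<lambda>x\<in>?M. ?c (?E (?c' x))) a = a"
      using a0 by (simp add: cM c'c Eid)
  next
    fix a b x assume "a \<in> ?c ` ?N" "b \<in> ?c ` ?N" "x \<in> ?M"
    then obtain a0 b0 where ab: "a0 \<in> ?N" "a = ?c a0" "b0 \<in> ?N" "b = ?c b0" by blast
    then have "a0 \<in> ?M" "b0 \<in> ?M" using NM by auto
    then have "compose (ell2 ?S) a (compose (ell2 ?S) x b) \<in> ?M"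
      using ab cM cl(2) \<open>x \<in> ?M\<close> by simp
    then show "(\<lambda>x\<in>?M. ?c (?E (?c' x))) (compose (ell2 ?S) a (compose (ell2 ?S) x b)) =
      compose (ell2 ?S) a (compose (ell2 ?S) ((\<lambda>x\<in>?M. ?c (?E (?c' x))) x) b)"
      using bimod[OF ab(1,3) \<open>x \<in> ?M\<close>] ab \<open>x \<in> ?M\<close> by simp
  next
    fix x assume "x \<in> ?M"
    then show "group_trace G ((\<lambda>x\<in>?M. ?c (?E (?c' x))) x) = group_trace G x"
      by (simp add: ctr ctr' Etr EM cM)
  qed
qed

lemma cond_exp_conjugate:
  assumes H: "subgroup H G" and u: "u \<in> unitaries (carrier G) (convolution_ops (carrier G))"
    and x: "x \<in> convolution_ops (carrier G)"
  shows "cond_exp (carrier G) (convolution_ops (carrier G)) (group_trace G)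
      (op_conj (carrier G) u ` convolution_ops H) x
    = op_conj (carrier G) u (coset_compression H (op_conj (carrier G) (op_adj (carrier G) u) x))"
proof -
  let ?S = "carrier G" and ?M = "convolution_ops (carrier G)" and ?N = "convolution_ops H"
  let ?c = "op_conj ?S u"
  have Mb: "?M \<subseteq> bounded_ops ?S" using convolution_ops_bounded by blast
  note up = unitaries_props[OF u Mb]
  have NM: "?N \<subseteq> ?M" by (rule convolution_ops_mono[OF subgroup.subset[OF H]])
  have Nb: "?N \<subseteq> bounded_ops ?S" using NM Mb by blast
  have cM: "?c a \<in> ?M" if "a \<in> ?N" for a
    by (rule op_conj_convolution_ops[OF up(1) subsetD[OF NM that]])
  have "?c (op_one ?S) = op_one ?S"
    using up by (intro op_eqI[where S = ?S]) (auto simp: op_conj_apply)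
  then have one: "op_one ?S \<in> ?c ` ?N" using convolution_ops_one[OF H] by (metis imageI)
  have diff: "op_diff ?S a b \<in> ?c ` ?N" if m: "a \<in> ?c ` ?N" "b \<in> ?c ` ?N" for a b
  proof -
    obtain a0 b0 where ab: "a0 \<in> ?N" "a = ?c a0" "b0 \<in> ?N" "b = ?c b0" using m by blast
    have "a0 \<in> bounded_ops ?S" "b0 \<in> bounded_ops ?S" using ab Nb by auto
    then have "op_diff ?S a b = ?c (op_diff ?S a0 b0)"
      unfolding ab using up(2)
      by (intro op_eqI[where S = ?S]) (auto simp: op_conj_apply bounded_ops_diff[OF up(2)])
    then show ?thesis using convolution_ops_diff[OF H ab(1,3)] by blast
  qed
  have adj: "op_adj ?S a \<in> ?c ` ?N" if m: "a \<in> ?c ` ?N" for a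
  proof -
    obtain a0 where a0: "a0 \<in> ?N" "a = ?c a0" using m by blast
    have "op_adj ?S a = ?c (op_adj ?S a0)"
      using a0 Nb op_adj_op_conj[OF up(2)] by auto
    then show ?thesis using convolution_ops_adj[OF H a0(1)] by blast
  qed
  have "cond_exp ?S ?M (group_trace G) (?c ` ?N)
    = (\<lambda>x\<in>?M. ?c (coset_compression H (op_conj ?S (op_adj ?S u) x)))"
    using cM by (intro cond_exp_eqI one diff adj conjugate_cond_exp[OF H u]) auto
  then show ?thesis using x by simp
qed

section \<open>Double cosets and maximality\<close>

lemma inv_mult_cancel:
  assumes "x \<in> carrier G" "y \<in> carrier G"
  shows "inv x \<otimes> (x \<otimes> y) = y" "x \<otimes> (inv x \<otimes> y) = y"
  using assms by (simp_all add: m_assoc[symmetric])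

text \<open>The form in which the covering hypothesis is used. A failure for \<^term>\<open>F\<close> means that each
  \<open>\<gamma> \<in> H\<close> lies in \<open>x\<^sup>-\<^sup>1 H y\<^sup>-\<^sup>1\<close> for some \<open>x\<close>, \<open>y\<close> in \<^term>\<open>F\<close>, so the inverses of \<^term>\<open>F\<close>
  produce a covering by translates although none of them lies in \<^term>\<open>H\<close>.\<close>
lemma not_covered_imp_separation:
  assumes H: "subgroup H G"
    and cov: "\<And>(m::nat) (x::nat \<Rightarrow> 'a).
           (\<forall>i\<in>{1..m}. x i \<in> carrier G) \<Longrightarrow>
           H \<subseteq> (\<Union>i\<in>{1..m}. \<Union>j\<in>{1..m}. (x i <#\<^bsub>G\<^esub> H) #>\<^bsub>G\<^esub> x j) \<Longrightarrow>
           \<exists>i\<in>{1..m}. x i \<in> H"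
    and F: "finite F" "F \<subseteq> carrier G" "F \<inter> H = {}"
  shows "\<exists>\<gamma>\<in>H. \<forall>x\<in>F. \<forall>y\<in>F. x \<otimes> \<gamma> \<otimes> y \<notin> H"
proof (rule ccontr)
  assume neg: "\<not> ?thesis"
  define m where "m = card ((\<lambda>x. inv x) ` F)"
  obtain x where x: "bij_betw x {1..m} ((\<lambda>x. inv x) ` F)"
    unfolding m_def using ex_bij_betw_nat_finite_1[of "(\<lambda>x. inv x) ` F"] F(1) by blast
  have im: "x ` {1..m} = (\<lambda>x. inv x) ` F" using x by (rule bij_betw_imp_surj_on)
  have "H \<subseteq> (\<Union>i\<in>{1..m}. \<Union>j\<in>{1..m}. (x i <#\<^bsub>G\<^esub> H) #>\<^bsub>G\<^esub> x j)"
  proof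
    fix \<gamma> assume \<gamma>: "\<gamma> \<in> H"
    then obtain a b where ab: "a \<in> F" "b \<in> F" "a \<otimes> \<gamma> \<otimes> b \<in> H" using neg by blast
    have G: "a \<in> carrier G" "b \<in> carrier G" "\<gamma> \<in> carrier G"
      using ab F(2) \<gamma> subgroup.mem_carrier[OF H] by auto
    have "\<gamma> = inv a \<otimes> (a \<otimes> \<gamma> \<otimes> b) \<otimes> inv b"
      using G by (simp add: m_assoc inv_mult_cancel)
    moreover have "inv a \<in> x ` {1..m}" "inv b \<in> x ` {1..m}" unfolding im using ab by blast+
    ultimately show "\<gamma> \<in> (\<Union>i\<in>{1..m}. \<Union>j\<in>{1..m}. (x i <#\<^bsub>G\<^esub> H) #>\<^bsub>G\<^esub> x j)"
      using ab(3) unfolding l_coset_def r_coset_def by force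
  qed
  moreover have "\<forall>i\<in>{1..m}. x i \<in> carrier G" 
  proof
    fix i assume "i \<in> {1..m}"
    then have "x i \<in> (\<lambda>x. inv x) ` F" using im by blast
    then show "x i \<in> carrier G" using F(2) by auto
  qed
  ultimately obtain i where i: "i \<in> {1..m}" "x i \<in> H" using cov by blast
  then have "x i \<in> (\<lambda>x. inv x) ` F" using im by blast
  then obtain a where a: "a \<in> F" "x i = inv a" by blast
  have "inv (inv a) \<in> H" using i a subgroup.m_inv_closed[OF H] by metis
  moreover have "a \<in> carrier G" using a(1) F(2) by blast
  ultimately show False using a(1) F(3) by auto
qed

text \<open>Commuting with \<open>\<lambda>\<^sub>h\<close> makes the coefficients of \<^term>\<open>T\<close> constant on orbits of conjugation by
  \<^term>\<open>H\<close>, and such a function is square summable only if it vanishes on infinite orbits. If \<open>g \<notin> H\<close> had a finite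
  orbit, separation would apply to this orbit together with its inverses; but for every \<open>\<gamma> \<in> H\<close>
  the product \<open>g \<gamma> (\<gamma>\<^sup>-\<^sup>1 g\<^sup>-\<^sup>1 \<gamma>) = \<gamma>\<close> lies in \<^term>\<open>H\<close>.\<close>
lemma relative_commutant_convolution_ops:
  assumes H: "subgroup H G"
    and sep: "\<And>F. finite F \<Longrightarrow> F \<subseteq> carrier G \<Longrightarrow> F \<inter> H = {} \<Longrightarrow>
      \<exists>\<gamma>\<in>H. \<forall>x\<in>F. \<forall>y\<in>F. x \<otimes> \<gamma> \<otimes> y \<notin> H"
    and T: "T \<in> convolution_ops (carrier G)"
    and comm: "T \<in> commutant (carrier G) (left_regular G ` H)"
  shows "T \<in> convolution_ops H"
proof (rule convolution_opsI)
  let ?S = "carrier G"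
  let ?\<xi> = "T (unit_vec \<one>)"
  show Tb: "T \<in> bounded_ops ?S" using T by (rule convolution_ops_bounded)
  show "T (unit_vec y) b = ?\<xi> (b \<otimes> inv y)" if "y \<in> ?S" "b \<in> ?S" for y b
    by (rule convolution_ops_matrix[OF T that])
  fix g assume g: "g \<in> ?S" "g \<notin> H"
  show "?\<xi> g = 0"
  proof (rule ccontr)
    assume nz: "?\<xi> g \<noteq> 0"
    have inv: "?\<xi> (h \<otimes> c \<otimes> inv h) = ?\<xi> c" if h: "h \<in> H" and c: "c \<in> ?S" for h c
    proof -
      have hG: "h \<in> ?S" using subgroup.mem_carrier[OF H h] .
      have "T (unit_vec h) = left_regular G h ?\<xi>"
        using commutantD[OF comm imageI[OF h], of "unit_vec \<one>"] hG by (simp add: left_regular_unit_vec)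
      then have "T (unit_vec h) (h \<otimes> c) = ?\<xi> c"
        using hG c Tb by (simp add: left_regular_def m_assoc[symmetric])
      then show ?thesis using convolution_ops_matrix[OF T hG, of "h \<otimes> c"] hG c by simp
    qed
    define Orb where "Orb = (\<lambda>h. h \<otimes> g \<otimes> inv h) ` H"
    have hG: "h \<in> ?S" if "h \<in> H" for h using subgroup.mem_carrier[OF H that] .
    have OG: "Orb \<subseteq> ?S" using hG g by (auto simp: Orb_def)
    have "Orb \<subseteq> {x \<in> ?S. ?\<xi> x = ?\<xi> g}" using OG inv g by (auto simp: Orb_def)
    then have finO: "finite Orb"
      using ell2_level_set_finite[OF bounded_ops_values[OF Tb unit_vec_ell2[OF one_closed]] nz]
      by (rule finite_subset)
    have OH: "x \<notin> H" if "x \<in> Orb" for x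
    proof
      assume "x \<in> H"
      obtain h where h: "h \<in> H" "x = h \<otimes> g \<otimes> inv h" using \<open>x \<in> Orb\<close> by (auto simp: Orb_def)
      have "inv h \<otimes> x \<otimes> h \<in> H"
        using \<open>x \<in> H\<close> h(1) subgroup.m_closed[OF H] subgroup.m_inv_closed[OF H] by blast
      moreover have "inv h \<otimes> x \<otimes> h = g"
        using hG[OF h(1)] g unfolding h(2) by (simp add: m_assoc inv_mult_cancel)
      ultimately show False using g by simp
    qed
    \<comment> \<open>The inverses are included so that \<open>\<gamma>\<^sup>-\<^sup>1 g\<^sup>-\<^sup>1 \<gamma>\<close> is available as second factor.\<close>
    let ?F = "Orb \<union> (\<lambda>x. inv x) ` Orb"
    have "inv x \<notin> H" if "x \<in> Orb" for x
      using OH[OF that] OG that subgroup.m_inv_closed[OF H, of "inv x"] by auto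
    then obtain \<gamma> where \<gamma>: "\<gamma> \<in> H" "\<forall>x\<in>?F. \<forall>y\<in>?F. x \<otimes> \<gamma> \<otimes> y \<notin> H"
      using sep[of ?F] finO OG OH by fastforce
    have \<gamma>G: "\<gamma> \<in> ?S" using hG[OF \<gamma>(1)] .
    have "g \<in> Orb" using g subgroup.one_closed[OF H] by (auto simp: Orb_def intro!: image_eqI[of _ _ \<one>])
    moreover have "inv \<gamma> \<otimes> g \<otimes> \<gamma> \<in> Orb"
      using subgroup.m_inv_closed[OF H \<gamma>(1)] \<gamma>G by (auto simp: Orb_def intro!: image_eqI[of _ _ "inv \<gamma>"])
    ultimately have "g \<otimes> \<gamma> \<otimes> inv (inv \<gamma> \<otimes> g \<otimes> \<gamma>) \<notin> H" using \<gamma>(2) by blast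
    moreover have "g \<otimes> \<gamma> \<otimes> inv (inv \<gamma> \<otimes> g \<otimes> \<gamma>) = \<gamma>"
      using \<gamma>G g by (simp add: inv_mult_group m_assoc inv_mult_cancel)
    ultimately show False using \<gamma>(1) by simp
  qed
qed

lemma convolution_ops_commute:
  assumes H: "subgroup H G" and ab: "comm_group (G\<lparr>carrier := H\<rparr>)"
    and T: "T \<in> convolution_ops H" and U: "U \<in> convolution_ops H"
  shows "compose (ell2 (carrier G)) T U = compose (ell2 (carrier G)) U T"
proof -
  let ?S = "carrier G"
  have comm: "h \<otimes> k = k \<otimes> h" if "h \<in> H" "k \<in> H" for h k
    using comm_monoid.m_comm[OF comm_group.axioms(1)[OF ab], of h k] that by simp
  have "left_regular G ` H \<subseteq> commutant ?S (left_regular G ` H)"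
  proof
    fix L assume "L \<in> left_regular G ` H"
    then obtain h where h: "h \<in> H" "L = left_regular G h" by blast
    have hG: "h \<in> ?S" using subgroup.mem_carrier[OF H h(1)] .
    show "L \<in> commutant ?S (left_regular G ` H)"
    proof (rule commutantI)
      show "L \<in> bounded_ops ?S" using left_regular_bounded[OF hG] h by simp
    next
      fix V f assume "V \<in> left_regular G ` H" and f: "f \<in> ell2 ?S"
      then obtain k where k: "k \<in> H" "V = left_regular G k" by blast
      have kG: "k \<in> ?S" using subgroup.mem_carrier[OF H k(1)] .
      have e: "inv k \<otimes> (inv h \<otimes> x) = inv h \<otimes> (inv k \<otimes> x)" if "x \<in> ?S" for x
        using comm[OF subgroup.m_inv_closed[OF H k(1)] subgroup.m_inv_closed[OF H h(1)]] hG kG that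
        by (simp add: m_assoc[symmetric])
      have "left_regular G k f \<in> ell2 ?S" "left_regular G h f \<in> ell2 ?S"
        using bounded_ops_values[OF left_regular_bounded] hG kG f by blast+
      then show "L (V f) = V (L f)"
        using f e by (auto simp: h(2) k(2) left_regular_def hG kG)
    qed
  qed
  then have "commutant ?S (commutant ?S (left_regular G ` H)) \<subseteq> commutant ?S (left_regular G ` H)"
    by (rule commutant_antimono)
  then have "U \<in> commutant ?S (left_regular G ` H)"
    using U double_commutant_left_regular[OF H] by blast
  then show ?thesis by (rule convolution_ops_commute_commutant[OF H T])
qed

text \<open>A larger abelian algebra commutes with the translations by \<^term>\<open>H\<close>, so maximality is the
  statement on the relative commutant.\<close>
lemma masa_convolution_ops:
  assumes H: "subgroup H G" and ab: "comm_group (G\<lparr>carrier := H\<rparr>)"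
    and sep: "\<And>F. finite F \<Longrightarrow> F \<subseteq> carrier G \<Longrightarrow> F \<inter> H = {} \<Longrightarrow>
      \<exists>\<gamma>\<in>H. \<forall>x\<in>F. \<forall>y\<in>F. x \<otimes> \<gamma> \<otimes> y \<notin> H"
  shows "masa (carrier G) (convolution_ops (carrier G)) (convolution_ops H)"
  unfolding masa_def
proof (intro conjI allI impI)
  show "abelian_sa_subalgebra (carrier G) (convolution_ops (carrier G)) (convolution_ops H)"
    unfolding abelian_sa_subalgebra_def
  proof (intro conjI ballI allI)
    show "convolution_ops H \<noteq> {}" using convolution_ops_one[OF H] by (metis empty_iff)
  qed (rule convolution_ops_mono[OF subgroup.subset[OF H]] convolution_ops_add[OF H]
      convolution_ops_scale[OF H] convolution_ops_compose[OF H] convolution_ops_adj[OF H]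
      convolution_ops_commute[OF H ab]; assumption)+
next
  fix B assume B: "abelian_sa_subalgebra (carrier G) (convolution_ops (carrier G)) B \<and> convolution_ops H \<subseteq> B"
  have "T \<in> convolution_ops H" if T: "T \<in> B" for T
  proof (rule relative_commutant_convolution_ops[OF H sep])
    show TM: "T \<in> convolution_ops (carrier G)" using T B by (auto simp: abelian_sa_subalgebra_def)
    have "compose (ell2 (carrier G)) T U = compose (ell2 (carrier G)) U T" if "U \<in> left_regular G ` H" for U
      using that B T left_regular_in_convolution_ops[OF H] unfolding abelian_sa_subalgebra_def by blast
    then show "T \<in> commutant (carrier G) (left_regular G ` H)"
      using convolution_ops_bounded[OF TM] by (simp add: commutant_def)
  qed
  then show "B = convolution_ops H" using B by blast
qed

section \<open>Strong singularity\<close>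

lemma off_subgroup_approx:
  assumes f: "f \<in> ell2 (carrier G)" and e: "0 < e"
  obtains F where "finite F" "F \<subseteq> carrier G" "F \<inter> H = {}"
    "ell2_norm (carrier G) (restr (- (H \<union> F)) f) < e"
proof -
  have r: "restr (- H) f \<in> ell2 (carrier G)" using f by (rule restr_ell2)
  obtain F where F: "finite F" "F \<subseteq> carrier G"
    "ell2_norm (carrier G) (\<lambda>x. restr (- H) f x - restr F (restr (- H) f) x) < e"
    using ell2_finite_approx[OF r e] by blast
  have "(\<lambda>x. restr (- H) f x - restr F (restr (- H) f) x) = restr (- (H \<union> (F - H))) f"
    by (auto simp: restr_def)
  then show ?thesis using F by (intro that[of "F - H"]) auto
qed

text \<open>For \<open>V = u\<^sup>*\<close> and \<open>\<xi> = u \<delta>\<^sub>1\<close> the vector on the left is the coefficient vector of the expectation of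
  \<open>u\<^sup>* \<lambda>\<^sub>\<gamma> u\<close>. The part of \<^term>\<open>\<xi>\<close> inside \<^term>\<open>H\<close> contributes at most its norm, since \<^term>\<open>V\<close> is a
  contraction. Up to a small error the rest of \<^term>\<open>\<xi>\<close> lives on a finite set \<open>F\<close> off \<^term>\<open>H\<close>, and
  for \<open>y \<in> F\<close> the vector \<open>V \<delta>\<^bsub>\<gamma> y\<^esub>\<close> restricted to \<^term>\<open>H\<close> sees only the coefficients of \<^term>\<open>V\<close> on
  \<open>H y\<^sup>-\<^sup>1 \<gamma>\<^sup>-\<^sup>1\<close>. This set misses \<^term>\<open>H\<close> because \<open>y \<notin> H\<close>, separation makes it miss any prescribed
  finite set \<open>F'\<close> off \<^term>\<open>H\<close> as well, and outside \<open>H \<union> F'\<close> the coefficients of \<^term>\<open>V\<close> are small.\<close>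
lemma asymptotic_homomorphism_estimate:
  assumes H: "subgroup H G"
    and sep: "\<And>F. finite F \<Longrightarrow> F \<subseteq> carrier G \<Longrightarrow> F \<inter> H = {} \<Longrightarrow>
      \<exists>\<gamma>\<in>H. \<forall>x\<in>F. \<forall>y\<in>F. x \<otimes> \<gamma> \<otimes> y \<notin> H"
    and V: "V \<in> convolution_ops (carrier G)"
    and contr: "\<And>f. f \<in> ell2 (carrier G) \<Longrightarrow> ell2_norm (carrier G) (V f) \<le> ell2_norm (carrier G) f"
    and \<xi>: "\<xi> \<in> ell2 (carrier G)" and e: "0 < e"
  shows "\<exists>\<gamma>\<in>H. ell2_norm (carrier G) (restr H (V (left_regular G \<gamma> \<xi>)))
    \<le> ell2_norm (carrier G) (restr H \<xi>) + e"
proof -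
  let ?S = "carrier G" and ?n = "ell2_norm (carrier G)"
  let ?\<zeta> = "V (unit_vec \<one>)"
  have Vb: "V \<in> bounded_ops ?S" using V by (rule convolution_ops_bounded)
  have \<zeta>: "?\<zeta> \<in> ell2 ?S" using Vb by simp
  obtain F where F: "finite F" "F \<subseteq> ?S" "F \<inter> H = {}" "?n (restr (- (H \<union> F)) \<xi>) < e / 2"
    using off_subgroup_approx[OF \<xi>, of "e / 2"] e by auto
  define s where "s = (\<Sum>y\<in>F. cmod (\<xi> y))"
  have s: "0 \<le> s" by (simp add: s_def sum_nonneg)
  \<comment> \<open>The finite set \<open>F\<close> comes first: the tolerance for the coefficients of \<^term>\<open>V\<close> depends on the
    coefficients of \<^term>\<open>\<xi>\<close> on \<open>F\<close>. The summand \<open>1\<close> keeps the denominator positive when \<open>s = 0\<close>.\<close>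
  define e' where "e' = e / (2 * (1 + s))"
  have e': "0 < e'" "e' * s \<le> e / 2" using e s by (auto simp: e'_def field_simps)
  obtain F' where F': "finite F'" "F' \<subseteq> ?S" "F' \<inter> H = {}" "?n (restr (- (H \<union> F')) ?\<zeta>) < e'"
    using off_subgroup_approx[OF \<zeta> e'(1)] by blast
  obtain \<gamma> where \<gamma>: "\<gamma> \<in> H" "\<forall>x\<in>F' \<union> F. \<forall>y\<in>F' \<union> F. x \<otimes> \<gamma> \<otimes> y \<notin> H"
  proof -
    have "finite (F' \<union> F)" "F' \<union> F \<subseteq> ?S" "(F' \<union> F) \<inter> H = {}" using F(1-3) F'(1-3) by auto
    from sep[OF this] show ?thesis using that by blast
  qed
  have \<gamma>G: "\<gamma> \<in> ?S" using subgroup.mem_carrier[OF H \<gamma>(1)] .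
  define W where "W = compose (ell2 ?S) (restr_op ?S H) (compose (ell2 ?S) V (left_regular G \<gamma>))"
  have Wb: "W \<in> bounded_ops ?S"
    unfolding W_def by (intro compose_bounded restr_op_bounded Vb left_regular_bounded[OF \<gamma>G])
  have l: "left_regular G \<gamma> f \<in> ell2 ?S" if "f \<in> ell2 ?S" for f
    using left_regular_bounded[OF \<gamma>G] that by simp
  have W: "W f = restr H (V (left_regular G \<gamma> f))" if "f \<in> ell2 ?S" for f
    using that l[OF that] Vb by (simp add: W_def restr_op_def)
  have Wcontr: "?n (W f) \<le> ?n f" if f: "f \<in> ell2 ?S" for f
  proof -
    have "?n (W f) \<le> ?n (V (left_regular G \<gamma> f))"
      unfolding W[OF f] by (rule restr_ell2(2)[OF bounded_ops_values[OF Vb l[OF f]]])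
    also have "\<dots> \<le> ?n (left_regular G \<gamma> f)" by (rule contr[OF l[OF f]])
    also have "\<dots> = ?n f" by (rule left_regular_norm[OF \<gamma>G f])
    finally show ?thesis .
  qed
  have small: "?n (W (unit_vec y)) \<le> e'" if y: "y \<in> F" for y
  proof -
    have yG: "y \<in> ?S" using y F(2) by blast
    let ?w = "\<gamma> \<otimes> y" and ?z = "restr (- (H \<union> F')) ?\<zeta>"
    let ?R = "perm_op ?S (\<lambda>x. x \<otimes> inv (\<gamma> \<otimes> y))"
    have wG: "?w \<in> ?S" using \<gamma>G yG by simp
    have bij: "bij_betw (\<lambda>x. x \<otimes> inv ?w) ?S ?S" using wG by (intro bij_right_mult) simp
    have z: "?z \<in> ell2 ?S" by (rule restr_ell2(1)[OF \<zeta>])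
    have "W (unit_vec y) = restr H (V (unit_vec ?w))"
      using W[of "unit_vec y"] yG by (simp add: left_regular_unit_vec \<gamma>G)
    also have "\<dots> = restr H (?R ?z)"
    proof
      fix b
      show "restr H (V (unit_vec ?w)) b = restr H (?R ?z) b"
      proof (cases "b \<in> H")
        case True
        have bG: "b \<in> ?S" using subgroup.mem_carrier[OF H True] .
        let ?c = "b \<otimes> inv ?w"
        have cG: "?c \<in> ?S" using bG wG by simp
        have cb: "?c \<otimes> \<gamma> \<otimes> y = b"
          using bG \<gamma>G yG by (simp add: m_assoc)
        have "?c \<notin> F'"
        proof
          assume "?c \<in> F'"
          then have "?c \<otimes> \<gamma> \<otimes> y \<notin> H" using \<gamma>(2) y by blast
          then show False using cb True by simp
        qed
        moreover have "?c \<notin> H"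
        proof
          assume "?c \<in> H"
          then have "?c \<otimes> \<gamma> \<in> H" using \<gamma>(1) by (rule subgroup.m_closed[OF H])
          then have "inv (?c \<otimes> \<gamma>) \<otimes> b \<in> H"
            using True subgroup.m_closed[OF H] subgroup.m_inv_closed[OF H] by blast
          moreover have "inv (?c \<otimes> \<gamma>) \<otimes> b = y"
            using inv_mult_cancel(1)[OF m_closed[OF cG \<gamma>G] yG] unfolding cb .
          ultimately have "y \<in> H" by (simp only:)
          then show False using y F(3) by blast
        qed
        ultimately have "?c \<in> - (H \<union> F')" by blast
        then have "?z ?c = ?\<zeta> ?c" by (rule restr_in)
        moreover have "?R ?z b = ?z ?c" unfolding perm_op_def using z bG by simp
        ultimately have "?R ?z b = ?\<zeta> ?c" by (simp only:)
        moreover have "V (unit_vec ?w) b = ?\<zeta> ?c" by (rule convolution_ops_matrix[OF V wG bG])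
        ultimately show ?thesis using True by simp
      qed simp
    qed
    finally have "?n (W (unit_vec y)) = ?n (restr H (?R ?z))" by (rule arg_cong)
    also have "\<dots> \<le> ?n (?R ?z)"
      by (rule restr_ell2(2)[OF bounded_ops_values[OF perm_op_bounded[OF bij] z]])
    also have "\<dots> = ?n ?z" by (rule perm_op_norm[OF bij z])
    also have "\<dots> \<le> e'" using F'(4) by (rule less_imp_le)
    finally show ?thesis .
  qed
  note fin = bounded_op_finite_support_norm[OF Wb F(1,2) small, of \<xi>]
  have h: "restr H \<xi> \<in> ell2 ?S" "restr (- (H \<union> F)) \<xi> \<in> ell2 ?S" using restr_ell2(1)[OF \<xi>] by auto
  have "\<xi> = (\<lambda>x. restr H \<xi> x + (restr (- (H \<union> F)) \<xi> x + restr F \<xi> x))"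
    using F(3) by (intro ext) (auto simp: restr_def)
  then have "W \<xi> = W (\<lambda>x. restr H \<xi> x + (restr (- (H \<union> F)) \<xi> x + restr F \<xi> x))" by simp
  also have "\<dots> = (\<lambda>x. W (restr H \<xi>) x + (W (restr (- (H \<union> F)) \<xi>) x + W (restr F \<xi>) x))"
    using bounded_ops_linear(1)[OF Wb h(1) ell2_add[OF h(2) conjunct1[OF fin]]]
      bounded_ops_linear(1)[OF Wb h(2) conjunct1[OF fin]] by simp
  finally have "?n (W \<xi>) \<le> ?n (W (restr H \<xi>)) + (?n (W (restr (- (H \<union> F)) \<xi>)) + ?n (W (restr F \<xi>)))"
    using ell2_norm_triangle[OF bounded_ops_values[OF Wb h(1)]
        ell2_add[OF bounded_ops_values[OF Wb h(2)] bounded_ops_values[OF Wb conjunct1[OF fin]]]]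
      ell2_norm_triangle[OF bounded_ops_values[OF Wb h(2)] bounded_ops_values[OF Wb conjunct1[OF fin]]]
    by simp
  also have "\<dots> \<le> ?n (restr H \<xi>) + (e / 2 + e / 2)"
    using Wcontr[OF h(1)] Wcontr[OF h(2)] F(4) fin e'(2) by (fold s_def) linarith
  finally show ?thesis using \<gamma>(1) W[OF \<xi>] by auto
qed

text \<open>The trace norm is invariant under multiplication by a unitary on the left; passing to adjoints, which
  preserves the trace norm, moves the other unitary factor to the left as well.\<close>
lemma op_conj_unit_vec_norm:
  assumes u: "u \<in> unitaries (carrier G) (convolution_ops (carrier G))"
    and z: "z \<in> convolution_ops (carrier G)"
  shows "ell2_norm (carrier G) (op_conj (carrier G) u z (unit_vec \<one>)) = ell2_norm (carrier G) (z (unit_vec \<one>))"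
proof -
  let ?S = "carrier G" and ?M = "convolution_ops (carrier G)" and ?d = "unit_vec \<one> :: 'a vec"
  have Mb: "?M \<subseteq> bounded_ops ?S" using convolution_ops_bounded by blast
  note up = unitaries_props[OF u Mb]
  have zb: "z \<in> bounded_ops ?S" using z Mb by blast
  have d: "?d \<in> ell2 ?S" by simp
  have "ell2_norm ?S (op_conj ?S u z ?d) = ell2_norm ?S (compose (ell2 ?S) z (op_adj ?S u) ?d)"
    using unitary_norm(1)[OF u Mb] zb up(2) by (simp add: op_conj_apply)
  also have "\<dots> = ell2_norm ?S (op_adj ?S (compose (ell2 ?S) z (op_adj ?S u)) ?d)"
    using ell2_norm_adj_unit_vec[OF convolution_ops_compose[OF subgroup_self z convolution_ops_adj[OF subgroup_self up(1)]]]
    by simp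
  also have "\<dots> = ell2_norm ?S (u (op_adj ?S z ?d))"
    using op_adj_compose[OF zb op_adj_bounded[OF up(2)]] op_adj_op_adj[OF up(2)] by simp
  also have "\<dots> = ell2_norm ?S (op_adj ?S z ?d)"
    by (rule unitary_norm(1)[OF u Mb bounded_ops_values[OF op_adj_bounded[OF zb] d]])
  also have "\<dots> = ell2_norm ?S (z ?d)" by (rule ell2_norm_adj_unit_vec[OF z])
  finally show ?thesis .
qed

text \<open>The supremum is tested at \<open>v = \<lambda>\<^sub>\<gamma>\<close> with \<open>\<gamma> \<in> H\<close>. As \<open>v\<close> is fixed by the first expectation, the
  distance of the two images of \<open>v\<close> is that between \<open>u\<^sup>* v u\<close> and its expectation, whose square is
  \<open>1 - p\<^sup>2\<close> with \<open>p\<close> the trace norm of the expectation. A suitable \<open>\<gamma>\<close> makes \<open>p\<close> at most \<open>a + e\<close>, where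
  \<open>a\<close> is the trace norm of the expectation of \<^term>\<open>u\<close>, and \<open>1 - a\<^sup>2\<close> is the square of the
  left-hand side.\<close>
lemma strongly_singular_convolution_ops:
  assumes H: "subgroup H G"
    and sep: "\<And>F. finite F \<Longrightarrow> F \<subseteq> carrier G \<Longrightarrow> F \<inter> H = {} \<Longrightarrow>
      \<exists>\<gamma>\<in>H. \<forall>x\<in>F. \<forall>y\<in>F. x \<otimes> \<gamma> \<otimes> y \<notin> H"
    and u: "u \<in> unitaries (carrier G) (convolution_ops (carrier G))"
  defines "E \<equiv> cond_exp (carrier G) (convolution_ops (carrier G)) (group_trace G) (convolution_ops H)"
    and "E\<^sub>u \<equiv> cond_exp (carrier G) (convolution_ops (carrier G)) (group_trace G)
                (op_conj (carrier G) u ` convolution_ops H)"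
  shows "trace_norm2 (carrier G) (group_trace G) (op_diff (carrier G) u (E u))
    \<le> norm_inf_2 (carrier G) (convolution_ops (carrier G)) (group_trace G)
        (\<lambda>x. op_diff (carrier G) (E x) (E\<^sub>u x))"
    (is "?r \<le> ?N")
proof -
  let ?S = "carrier G" and ?M = "convolution_ops (carrier G)" and ?A = "convolution_ops H"
  let ?d = "unit_vec \<one> :: 'a vec" and ?n = "ell2_norm (carrier G)"
  let ?c = "op_conj ?S u" and ?c' = "op_conj ?S (op_adj ?S u)" and ?P = "coset_compression H"
  have Mb: "?M \<subseteq> bounded_ops ?S" using convolution_ops_bounded by blast
  have b: "x \<in> bounded_ops ?S" if "x \<in> ?M" for x using that Mb by blast
  note up = unitaries_props[OF u Mb] and un = unitary_norm[OF u Mb]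
  have d: "?d \<in> ell2 ?S" "?n ?d = 1" by simp_all
  have AM: "?A \<subseteq> ?M" by (rule convolution_ops_mono[OF subgroup.subset[OF H]])
  have u'M: "op_adj ?S u \<in> ?M" by (rule convolution_ops_adj[OF subgroup_self up(1)])
  have E: "E x = ?P x" if "x \<in> ?M" for x
    unfolding E_def by (rule cond_exp_eq_coset_compression[OF H that])
  have Eu: "E\<^sub>u x = ?c (?P (?c' x))" if "x \<in> ?M" for x
    unfolding E\<^sub>u_def by (rule cond_exp_conjugate[OF H u that])
  have PM: "?P x \<in> ?M" if "x \<in> ?M" for x using coset_compression_mem[OF H that] AM by blast
  have Pd: "?P x ?d = restr H (x ?d)" if "x \<in> ?M" for x
    by (rule coset_compression_unit_vec[OF H b[OF that]])
  have cM: "?c x \<in> ?M" "?c' x \<in> ?M" if "x \<in> ?M" for x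
    using op_conj_convolution_ops[OF up(1) that] op_conj_convolution_ops[OF u'M that] .
  have ca: "?c x f = u (x (op_adj ?S u f))" "?c' x f = op_adj ?S u (x (u f))" if "f \<in> ell2 ?S" for x f
    using that up(2) by (simp_all add: op_conj_apply op_adj_op_adj)
  have t: "trace_norm2 ?S (group_trace G) (op_diff ?S x y) = ?n (\<lambda>g. x ?d g - y ?d g)"
    if "x \<in> ?M" "y \<in> ?M" for x y
    using trace_norm2_group_trace[OF op_diff_bounded[OF b[OF that(1)] b[OF that(2)]]] by simp
  \<comment> \<open>A supremum of reals says something only for a bounded family; both expectations are contractions
    for the trace norm.\<close>
  have bdd: "bdd_above ((\<lambda>x. trace_norm2 ?S (group_trace G) (op_diff ?S (E x) (E\<^sub>u x))) ` {x \<in> ?M. op_norm ?S x \<le> 1})"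
  proof (rule bdd_aboveI2[where M = 2])
    fix x assume "x \<in> {x \<in> ?M. op_norm ?S x \<le> 1}"
    then have x: "x \<in> ?M" "op_norm ?S x \<le> 1" by auto
    have le: "?n (x f) \<le> 1" if "f \<in> ell2 ?S" "?n f = 1" for f
      using op_norm_bound[OF b[OF x(1)] that(1)] that(2) x(2) by simp
    have P: "?n (?P y ?d) \<le> ?n (y ?d)" if "y \<in> ?M" for y
      unfolding Pd[OF that] by (rule restr_ell2(2)[OF bounded_ops_values[OF b[OF that] d(1)]])
    have 1: "?n (?P x ?d) \<le> 1" using P[OF x(1)] le[OF d] by simp
    have "?n (?c (?P (?c' x)) ?d) = ?n (?P (?c' x) ?d)"
      by (rule op_conj_unit_vec_norm[OF u PM[OF cM(2)[OF x(1)]]])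
    also have "\<dots> \<le> ?n (?c' x ?d)" by (rule P[OF cM(2)[OF x(1)]])
    also have "\<dots> = ?n (x (u ?d))" using ca(2)[OF d(1)] un(2) b[OF x(1)] up(2) by simp
    also have "\<dots> \<le> 1" using le up(2) un(1) by simp
    finally have 2: "?n (?c (?P (?c' x)) ?d) \<le> 1" .
    have M: "?P x \<in> ?M" "?c (?P (?c' x)) \<in> ?M" using PM cM x(1) by auto
    show "trace_norm2 ?S (group_trace G) (op_diff ?S (E x) (E\<^sub>u x)) \<le> 2"
      unfolding E[OF x(1)] Eu[OF x(1)] t[OF M]
      using ell2_norm_diff_triangle[OF bounded_ops_values[OF b[OF M(1)] d(1)] bounded_ops_values[OF b[OF M(2)] d(1)]] 1 2
      by simp
  qed
  let ?a = "?n (restr H (u ?d))"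
  have ud: "u ?d \<in> ell2 ?S" "?n (u ?d) = 1" using up(2) un(1)[OF d(1)] by auto
  have a1: "?a \<le> 1" using restr_ell2(2)[OF ud(1), of H] ud(2) by simp
  have diff_restr: "(\<lambda>g. f g - restr H f g) = restr (- H) f" for f :: "'a vec" by (auto simp: restr_def)
  have r: "?r = ?n (restr (- H) (u ?d))"
    unfolding E[OF up(1)] t[OF up(1) PM[OF up(1)]] Pd[OF up(1)] diff_restr ..
  have r2: "?r\<^sup>2 = 1 - ?a\<^sup>2" using ell2_pythagoras[OF ud(1), of H] ud(2) by (simp add: r)
  have key: "0 \<le> ?N \<and> 1 - (?a + e)\<^sup>2 \<le> ?N\<^sup>2" if e: "0 < e" for e
  proof -
    have "ell2_norm ?S (op_adj ?S u f) \<le> ell2_norm ?S f" if "f \<in> ell2 ?S" for f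
      using un(2)[OF that] by simp
    from asymptotic_homomorphism_estimate[OF H sep u'M this ud(1) e]
    obtain \<gamma> where \<gamma>: "\<gamma> \<in> H" "?n (restr H (op_adj ?S u (left_regular G \<gamma> (u ?d)))) \<le> ?a + e"
      by blast
    have \<gamma>G: "\<gamma> \<in> ?S" using subgroup.mem_carrier[OF H \<gamma>(1)] .
    let ?v = "left_regular G \<gamma>"
    have vA: "?v \<in> ?A" by (rule left_regular_in_convolution_ops[OF H \<gamma>(1)])
    have vM: "?v \<in> ?M" using vA AM by blast
    have v1: "op_norm ?S ?v \<le> 1" by (rule op_norm_leI) (simp add: left_regular_norm[OF \<gamma>G])
    let ?y = "?c' ?v"
    have yM: "?y \<in> ?M" by (rule cM(2)[OF vM])
    have yd: "?y ?d = op_adj ?S u (?v (u ?d))" by (rule ca(2)[OF d(1)])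
    have ydl: "?y ?d \<in> ell2 ?S" by (rule bounded_ops_values[OF b[OF yM] d(1)])
    have y1: "?n (?y ?d) = 1"
      unfolding yd using un(2)[OF bounded_ops_values[OF b[OF vM] ud(1)]] left_regular_norm[OF \<gamma>G ud(1)] ud(2) by simp
    have Pv: "?P ?v = ?v"
      using coset_compression_cond_exp[OF H] vA vM unfolding trace_preserving_cond_exp_def
      by (metis restrict_apply')
    have vd: "?v ?d = ?c ?y ?d"
    proof -
      have "op_adj ?S u ?d \<in> ell2 ?S" using up(2) by simp
      then show ?thesis using ca d(1) up b[OF vM] by simp
    qed
    have "trace_norm2 ?S (group_trace G) (op_diff ?S (E ?v) (E\<^sub>u ?v)) = ?n (\<lambda>g. ?c ?y ?d g - ?c (?P ?y) ?d g)"
      unfolding E[OF vM] Eu[OF vM] Pv t[OF vM cM(1)[OF PM[OF yM]]] vd[symmetric] ..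
    also have "(\<lambda>g. ?c ?y ?d g - ?c (?P ?y) ?d g) = ?c (op_diff ?S ?y (?P ?y)) ?d"
    proof -
      have u'd: "op_adj ?S u ?d \<in> ell2 ?S" using up(2) by simp
      show ?thesis
        using ca(1)[OF d(1)] u'd bounded_ops_diff[OF up(2)
          bounded_ops_values[OF b[OF yM] u'd] bounded_ops_values[OF b[OF PM[OF yM]] u'd]] by simp
    qed
    also have "?n \<dots> = ?n (op_diff ?S ?y (?P ?y) ?d)"
      by (rule op_conj_unit_vec_norm[OF u convolution_ops_diff[OF subgroup_self yM PM[OF yM]]])
    also have "op_diff ?S ?y (?P ?y) ?d = restr (- H) (?y ?d)"
      using Pd[OF yM] diff_restr d(1) by simp
    finally have tv: "trace_norm2 ?S (group_trace G) (op_diff ?S (E ?v) (E\<^sub>u ?v)) = ?n (restr (- H) (?y ?d))" .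
    have "?n (restr (- H) (?y ?d)) \<le> ?N"
      unfolding norm_inf_2_def tv[symmetric] by (rule cSUP_upper[OF _ bdd]) (use vM v1 in simp)
    then have N: "0 \<le> ?N" "(?n (restr (- H) (?y ?d)))\<^sup>2 \<le> ?N\<^sup>2"
      using ell2_norm_nonneg[of ?S "restr (- H) (?y ?d)"] by (linarith, intro power_mono) auto
    have "(?n (restr H (?y ?d)))\<^sup>2 \<le> (?a + e)\<^sup>2" using \<gamma>(2) by (intro power_mono) (auto simp: yd)
    moreover have "(?n (restr H (?y ?d)))\<^sup>2 + (?n (restr (- H) (?y ?d)))\<^sup>2 = 1"
      using ell2_pythagoras[OF ydl, of H] unfolding y1 by simp
    ultimately show ?thesis using N by linarith
  qed
  have "?r\<^sup>2 \<le> ?N\<^sup>2"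
  proof (rule field_le_epsilon)
    fix \<epsilon> :: real assume \<epsilon>: "0 < \<epsilon>"
    \<comment> \<open>For \<open>a \<le> 1\<close> and \<open>e \<le> 1\<close> the error \<open>(a + e)\<^sup>2 - a\<^sup>2 = 2 a e + e\<^sup>2\<close> is at most \<open>3 e\<close>.\<close>
    define e where "e = min 1 (\<epsilon> / 3)"
    have e: "0 < e" "e \<le> 1" "3 * e \<le> \<epsilon>" using \<epsilon> by (auto simp: e_def)
    have "?a * e \<le> 1 * e" "e * e \<le> 1 * e" using a1 e by (auto intro!: mult_right_mono)
    then have "(?a + e)\<^sup>2 \<le> ?a\<^sup>2 + 3 * e" by (simp add: power2_eq_square algebra_simps)
    then show "?r\<^sup>2 \<le> ?N\<^sup>2 + \<epsilon>" using key[OF e(1)] r2 e(3) by linarith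
  qed
  then show ?thesis using key[of 1] by (auto intro: power2_le_imp_le)
qed

end

theorem lemma4p1:
  fixes G :: "('a, 'b) monoid_scheme" and \<Gamma>\<^sub>0 :: "'a set"
  assumes "icc_group G"
    and "subgroup \<Gamma>\<^sub>0 G"
    and "comm_group (G\<lparr>carrier := \<Gamma>\<^sub>0\<rparr>)"
    and "\<And>(m::nat) (x::nat \<Rightarrow> 'a).
           (\<forall>i\<in>{1..m}. x i \<in> carrier G) \<Longrightarrow>
           \<Gamma>\<^sub>0 \<subseteq> (\<Union>i\<in>{1..m}. \<Union>j\<in>{1..m}. (x i <#\<^bsub>G\<^esub> \<Gamma>\<^sub>0) #>\<^bsub>G\<^esub> x j) \<Longrightarrow>
           \<exists>i\<in>{1..m}. x i \<in> \<Gamma>\<^sub>0"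
  shows "masa (carrier G) (VN G (carrier G)) (VN G \<Gamma>\<^sub>0) \<and>
         strongly_singular (carrier G) (VN G (carrier G)) (group_trace G) (VN G \<Gamma>\<^sub>0)"
proof -
  interpret group G using assms(1) by (simp add: icc_group_def)
  note H = assms(2)
  have sep: "\<exists>\<gamma>\<in>\<Gamma>\<^sub>0. \<forall>x\<in>F. \<forall>y\<in>F. x \<otimes>\<^bsub>G\<^esub> \<gamma> \<otimes>\<^bsub>G\<^esub> y \<notin> \<Gamma>\<^sub>0"
    if "finite F" "F \<subseteq> carrier G" "F \<inter> \<Gamma>\<^sub>0 = {}" for F
    by (rule not_covered_imp_separation[OF H assms(4) that])
  note VN = VN_eq_convolution_ops[OF H] VN_eq_convolution_ops(1)[OF subgroup_self]
  have "masa (carrier G) (VN G (carrier G)) (VN G \<Gamma>\<^sub>0)"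
    unfolding VN(1,3) by (rule masa_convolution_ops[OF H assms(3) sep])
  moreover have "strongly_singular (carrier G) (VN G (carrier G)) (group_trace G) (VN G \<Gamma>\<^sub>0)"
    unfolding strongly_singular_def
  proof (intro conjI ballI)
    show "von_neumann_algebra (carrier G) (VN G \<Gamma>\<^sub>0)" by (rule VN(2))
    show "VN G \<Gamma>\<^sub>0 \<subseteq> VN G (carrier G)"
      unfolding VN(1,3) by (rule convolution_ops_mono[OF subgroup.subset[OF H]])
  qed (unfold VN(1,3), rule strongly_singular_convolution_ops[OF H sep])
  ultimately show ?thesis ..
qed

end
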